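(* Let $R$ be a commutative ring and let $A$ be a symmetric $R$-algebra (finitely generated projective over $R$) with nonsingular associative symmetric $R$-bilinear form $\beta\colon A\times A\to R$. Let $e=e^2\in A$ be an idempotent and assume that the left $A$-module $M=Ae$ satisfies $\operatorname{End}_A(M)\cong R$ as $R$-algebras. Let $\omega_M\colon\mathcal{Z}(A)\to R$ be the central character of $M$, let $z(M)\in\mathcal{Z}(A)$ be the element determined by $\chi_M(a)=\beta(a,z(M))$ for all $a\in A$, and let $[A:M]_\beta=\omega_M(z(M))$. Then: (a) $[A:M]_\beta$ is invertible in $R$, with inverse $\beta(e,1)$. (b) $e(M):=[A:M]_\beta^{-1}z(M)\in\mathcal{Z}(A)$ is an idempotent satisfying $\omega_M(e(M))=1$ and $x\,e(M)=\omega_M(x)\,e(M)$ for all $x\in\mathcal{Z}(A)$. (c) Let $z=z_\beta=\sum_i x_iy_i\in\mathcal{Z}(A)$, where $\{x_i\},\{y_i\}$ are dual bases for $\beta$. Then $\omega_M(z)\cdot\operatorname{rank}_R M=[A:M]_\beta\cdot\operatorname{rank}_R e(M)A$.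
   Context: $\mathcal{Z}(A)$ is the center of $A$. An $R$-bilinear form $\beta$ on $A$ is nonsingular if $a\mapsto\beta(a,\cdot)$ is an isomorphism $A\to A^\vee=\operatorname{Hom}_R(A,R)$ (equivalently, $a\mapsto\beta(\cdot,a)$ is), associative if $\beta(xy,z)=\beta(x,yz)$, symmetric if $\beta(x,y)=\beta(y,x)$. The algebra $A$ is symmetric if such a nonsingular associative symmetric form exists. Dual bases for $\beta$ are finite families $\{x_i\}_1^n,\{y_i\}_1^n\subseteq A$ with $a=\sum_i\beta(a,y_i)x_i$ for all $a\in A$; they exist, and $\sum_i x_i\otimes y_i\in A\otimes_R A$ depends only on $\beta$. For a finitely generated projective $R$-module $N$, $\operatorname{Tr}\colon\operatorname{End}_R(N)\cong N\otimes_R N^\vee\to R$ is the trace map given by evaluation and $\operatorname{rank}_R N=\operatorname{Tr}(1_N)\in R$ is the Hattori–Stallings rank. For a left $A$-module $M$ that is finitely generated projective over $R$, let $a_M\in\operatorname{End}_R(M)$ be the action of $a\in A$; the character is $\chi_M(a)=\operatorname{Tr}(a_M)$. Explicitly $z(M)=\sum_i\chi_M(x_i)y_i$, and this is central since $\beta$ is symmetric. If $\operatorname{End}_A(M)\cong R$ as $R$-algebras, the central character $\omega_M\colon\mathcal{Z}(A)\to R$ is the $R$-algebra map defined by $x_M=\omega_M(x)1_M$. *)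

theory Defs
  imports "HOL-Algebra.Algebra"
begin

section \<open>Modules and algebras\<close>

text \<open>
  Modules are HOL-Algebra module records; their multiplicative fields \<open>mult\<close> and \<open>one\<close> are
  ignored. Homomorphisms are extensional functions, so that sets of homomorphisms can serve as
  carriers. The ring argument of \<open>mod_hom\<close> need not be commutative:
  \<open>mod_hom A M N\<close> is also used for left modules over a noncommutative ring \<open>A\<close>.
\<close>

definition mod_hom ::
  "('r, 'k) ring_scheme \<Rightarrow> ('r, 'a, 'm) module_scheme \<Rightarrow> ('r, 'b, 'n) module_scheme \<Rightarrow> ('a \<Rightarrow> 'b) set"
  where "mod_hom R M N =
    {f \<in> carrier M \<rightarrow>\<^sub>E carrier N.
      (\<forall>x\<in>carrier M. \<forall>y\<in>carrier M. f (x \<oplus>\<^bsub>M\<^esub> y) = f x \<oplus>\<^bsub>N\<^esub> f y) \<and>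
      (\<forall>r\<in>carrier R. \<forall>x\<in>carrier M. f (r \<odot>\<^bsub>M\<^esub> x) = r \<odot>\<^bsub>N\<^esub> f x)}"

definition mod_iso ::
  "('r, 'k) ring_scheme \<Rightarrow> ('r, 'a, 'm) module_scheme \<Rightarrow> ('r, 'b, 'n) module_scheme \<Rightarrow> ('a \<Rightarrow> 'b) set"
  where "mod_iso R M N = {f \<in> mod_hom R M N. bij_betw f (carrier M) (carrier N)}"

definition self_module :: "('a, 'k) ring_scheme \<Rightarrow> ('a, 'a) module"
  where "self_module A =
    \<lparr>carrier = carrier A, monoid.mult = monoid.mult A, one = one A,
     ring.zero = ring.zero A, ring.add = ring.add A, smult = monoid.mult A\<rparr>"

definition dual_module ::
  "('r, 'k) ring_scheme \<Rightarrow> ('r, 'a, 'm) module_scheme \<Rightarrow> ('r, 'a \<Rightarrow> 'r) module"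
  where "dual_module R N =
    \<lparr>carrier = mod_hom R N (self_module R), monoid.mult = undefined, one = undefined,
     ring.zero = (\<lambda>x\<in>carrier N. \<zero>\<^bsub>R\<^esub>),
     ring.add = (\<lambda>f g. \<lambda>x\<in>carrier N. f x \<oplus>\<^bsub>R\<^esub> g x),
     smult = (\<lambda>r f. \<lambda>x\<in>carrier N. r \<otimes>\<^bsub>R\<^esub> f x)\<rparr>"

definition free_module :: "('r, 'k) ring_scheme \<Rightarrow> nat \<Rightarrow> ('r, nat \<Rightarrow> 'r) module"
  where "free_module R n =
    \<lparr>carrier = {1..n} \<rightarrow>\<^sub>E carrier R, monoid.mult = undefined, one = undefined,
     ring.zero = (\<lambda>i\<in>{1..n}. \<zero>\<^bsub>R\<^esub>),
     ring.add = (\<lambda>v w. \<lambda>i\<in>{1..n}. v i \<oplus>\<^bsub>R\<^esub> w i),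
     smult = (\<lambda>r v. \<lambda>i\<in>{1..n}. r \<otimes>\<^bsub>R\<^esub> v i)\<rparr>"

text \<open>Finitely generated projective: isomorphic to a direct summand of some \<open>R\<^sup>n\<close>.\<close>

definition fg_projective :: "('r, 'k) ring_scheme \<Rightarrow> ('r, 'a, 'm) module_scheme \<Rightarrow> bool"
  where "fg_projective R N \<longleftrightarrow> module R N \<and>
    (\<exists>n P Q. submodule P R (free_module R n) \<and> submodule Q R (free_module R n) \<and>
      P \<inter> Q = {\<zero>\<^bsub>free_module R n\<^esub>} \<and>
      P <+>\<^bsub>free_module R n\<^esub> Q = carrier (free_module R n) \<and>
      mod_iso R N ((free_module R n)\<lparr>carrier := P\<rparr>) \<noteq> {})"

text \<open>
  The locale \<open>algebra\<close> of HOL-Algebra requires the algebra to be commutative; this one does not.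
\<close>

locale assoc_algebra = module R A + ring A for R (structure) and A (structure) +
  assumes smult_mult_left:
      "\<lbrakk>r \<in> carrier R; x \<in> carrier A; y \<in> carrier A\<rbrakk> \<Longrightarrow>
        (r \<odot>\<^bsub>A\<^esub> x) \<otimes>\<^bsub>A\<^esub> y = r \<odot>\<^bsub>A\<^esub> (x \<otimes>\<^bsub>A\<^esub> y)"
    and smult_mult_right:
      "\<lbrakk>r \<in> carrier R; x \<in> carrier A; y \<in> carrier A\<rbrakk> \<Longrightarrow>
        x \<otimes>\<^bsub>A\<^esub> (r \<odot>\<^bsub>A\<^esub> y) = r \<odot>\<^bsub>A\<^esub> (x \<otimes>\<^bsub>A\<^esub> y)"

definition alg_isomorphic ::
  "('r, 'k) ring_scheme \<Rightarrow> ('r, 'a, 'm) module_scheme \<Rightarrow> ('r, 'b, 'n) module_scheme \<Rightarrow> bool"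
  where "alg_isomorphic R A B \<longleftrightarrow> ring_iso A B \<inter> mod_hom R A B \<noteq> {}"

definition center :: "('a, 'k) ring_scheme \<Rightarrow> 'a set"
  where "center A = {x \<in> carrier A. \<forall>y\<in>carrier A. x \<otimes>\<^bsub>A\<^esub> y = y \<otimes>\<^bsub>A\<^esub> x}"

section \<open>Modules over an algebra\<close>

text \<open>
  A left \<open>A\<close>-module \<open>M\<close> is a record whose \<open>smult\<close> is the action of \<open>A\<close>. Its underlying
  \<open>R\<close>-module is obtained along the structure map sending \<open>r\<close> to \<open>r \<cdot> 1\<^sub>A\<close>.
\<close>

definition restrict_scalars ::
  "('r, 'a, 'm) module_scheme \<Rightarrow> ('a, 'b, 'n) module_scheme \<Rightarrow> ('r, 'b) module"
  where "restrict_scalars A M =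
    \<lparr>carrier = carrier M, monoid.mult = monoid.mult M, one = one M,
     ring.zero = ring.zero M, ring.add = ring.add M,
     smult = (\<lambda>r x. (r \<odot>\<^bsub>A\<^esub> \<one>\<^bsub>A\<^esub>) \<odot>\<^bsub>M\<^esub> x)\<rparr>"

definition End_alg ::
  "('r, 'a, 'm) module_scheme \<Rightarrow> ('a, 'b, 'n) module_scheme \<Rightarrow> ('r, 'b \<Rightarrow> 'b) module"
  where "End_alg A M =
    \<lparr>carrier = mod_hom A M M, monoid.mult = compose (carrier M), one = (\<lambda>x\<in>carrier M. x),
     ring.zero = (\<lambda>x\<in>carrier M. \<zero>\<^bsub>M\<^esub>),
     ring.add = (\<lambda>f g. \<lambda>x\<in>carrier M. f x \<oplus>\<^bsub>M\<^esub> g x),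
     smult = (\<lambda>r f. \<lambda>x\<in>carrier M. r \<odot>\<^bsub>restrict_scalars A M\<^esub> f x)\<rparr>"

definition principal_left_module :: "('a, 'k) ring_scheme \<Rightarrow> 'a \<Rightarrow> ('a, 'a) module"
  where "principal_left_module A e = (self_module A)\<lparr>carrier := (\<lambda>a. a \<otimes>\<^bsub>A\<^esub> e) ` carrier A\<rparr>"

text \<open>\<open>xA\<close>, viewed as an \<open>R\<close>-module.\<close>

definition principal_right_ideal :: "('r, 'a, 'm) module_scheme \<Rightarrow> 'a \<Rightarrow> ('r, 'a, 'm) module_scheme"
  where "principal_right_ideal A x = A\<lparr>carrier := (\<lambda>a. x \<otimes>\<^bsub>A\<^esub> a) ` carrier A\<rparr>"

section \<open>Trace, rank and characters\<close>

text \<open>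
  The element \<open>\<Sum>\<^sub>i x\<^sub>i \<otimes> \<phi>\<^sub>i\<close> of \<open>N \<otimes> N\<^sup>\<or>\<close> corresponds to the endomorphism
  \<open>\<Sum>\<^sub>i \<phi>\<^sub>i(\<cdot>) x\<^sub>i\<close> and evaluates to \<open>\<Sum>\<^sub>i \<phi>\<^sub>i(x\<^sub>i)\<close>. For finitely generated projective \<open>N\<close>
  every endomorphism arises from exactly one tensor, so the value below is well defined.
\<close>

definition trace :: "('r, 'k) ring_scheme \<Rightarrow> ('r, 'a, 'm) module_scheme \<Rightarrow> ('a \<Rightarrow> 'a) \<Rightarrow> 'r"
  where "trace R N f = (THE t. \<exists>(n::nat) x \<phi>.
    x \<in> {1..n} \<rightarrow> carrier N \<and> \<phi> \<in> {1..n} \<rightarrow> carrier (dual_module R N) \<and>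
    (\<forall>v\<in>carrier N. f v = (\<Oplus>\<^bsub>N\<^esub> i\<in>{1..n}. \<phi> i v \<odot>\<^bsub>N\<^esub> x i)) \<and>
    t = (\<Oplus>\<^bsub>R\<^esub> i\<in>{1..n}. \<phi> i (x i)))"

definition rank :: "('r, 'k) ring_scheme \<Rightarrow> ('r, 'a, 'm) module_scheme \<Rightarrow> 'r"
  where "rank R N = trace R N (\<lambda>x\<in>carrier N. x)"

definition character ::
  "('r, 'k) ring_scheme \<Rightarrow> ('r, 'a, 'm) module_scheme \<Rightarrow> ('a, 'b, 'n) module_scheme \<Rightarrow> 'a \<Rightarrow> 'r"
  where "character R A M a = trace R (restrict_scalars A M) (\<lambda>x\<in>carrier M. a \<odot>\<^bsub>M\<^esub> x)"

definition central_character ::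
  "('r, 'k) ring_scheme \<Rightarrow> ('r, 'a, 'm) module_scheme \<Rightarrow> ('a, 'b, 'n) module_scheme \<Rightarrow> 'a \<Rightarrow> 'r"
  where "central_character R A M x =
    (THE r. r \<in> carrier R \<and> (\<forall>m\<in>carrier M. x \<odot>\<^bsub>M\<^esub> m = r \<odot>\<^bsub>restrict_scalars A M\<^esub> m))"

section \<open>Bilinear forms\<close>

definition bilinear_form ::
  "('r, 'k) ring_scheme \<Rightarrow> ('r, 'a, 'm) module_scheme \<Rightarrow> ('a \<Rightarrow> 'a \<Rightarrow> 'r) \<Rightarrow> bool"
  where "bilinear_form R A \<beta> \<longleftrightarrow>
    (\<forall>x\<in>carrier A. (\<lambda>y\<in>carrier A. \<beta> x y) \<in> mod_hom R A (self_module R)) \<and>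
    (\<forall>y\<in>carrier A. (\<lambda>x\<in>carrier A. \<beta> x y) \<in> mod_hom R A (self_module R))"

definition nonsingular_form ::
  "('r, 'k) ring_scheme \<Rightarrow> ('r, 'a, 'm) module_scheme \<Rightarrow> ('a \<Rightarrow> 'a \<Rightarrow> 'r) \<Rightarrow> bool"
  where "nonsingular_form R A \<beta> \<longleftrightarrow>
    (\<lambda>x\<in>carrier A. \<lambda>y\<in>carrier A. \<beta> x y) \<in> mod_iso R A (dual_module R A)"

definition associative_form :: "('a, 'k) ring_scheme \<Rightarrow> ('a \<Rightarrow> 'a \<Rightarrow> 'r) \<Rightarrow> bool"
  where "associative_form A \<beta> \<longleftrightarrow>
    (\<forall>x\<in>carrier A. \<forall>y\<in>carrier A. \<forall>z\<in>carrier A. \<beta> (x \<otimes>\<^bsub>A\<^esub> y) z = \<beta> x (y \<otimes>\<^bsub>A\<^esub> z))"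

definition symmetric_form :: "('a, 'k) ring_scheme \<Rightarrow> ('a \<Rightarrow> 'a \<Rightarrow> 'r) \<Rightarrow> bool"
  where "symmetric_form A \<beta> \<longleftrightarrow> (\<forall>x\<in>carrier A. \<forall>y\<in>carrier A. \<beta> x y = \<beta> y x)"

definition dual_bases ::
  "('r, 'a, 'm) module_scheme \<Rightarrow> ('a \<Rightarrow> 'a \<Rightarrow> 'r) \<Rightarrow> nat \<Rightarrow> (nat \<Rightarrow> 'a) \<Rightarrow> (nat \<Rightarrow> 'a) \<Rightarrow> bool"
  where "dual_bases A \<beta> n x y \<longleftrightarrow>
    x \<in> {1..n} \<rightarrow> carrier A \<and> y \<in> {1..n} \<rightarrow> carrier A \<and>
    (\<forall>a\<in>carrier A. a = (\<Oplus>\<^bsub>A\<^esub> i\<in>{1..n}. \<beta> a (y i) \<odot>\<^bsub>A\<^esub> x i))"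

text \<open>The element \<open>z(M)\<close>, the scalar \<open>[A:M]\<^sub>\<beta>\<close> and the element \<open>e(M)\<close>.\<close>

definition character_element ::
  "('r, 'k) ring_scheme \<Rightarrow> ('r, 'a, 'm) module_scheme \<Rightarrow> ('a \<Rightarrow> 'a \<Rightarrow> 'r) \<Rightarrow>
    ('a, 'b, 'n) module_scheme \<Rightarrow> 'a"
  where "character_element R A \<beta> M =
    (THE z. z \<in> center A \<and> (\<forall>a\<in>carrier A. character R A M a = \<beta> a z))"

definition form_index ::
  "('r, 'k) ring_scheme \<Rightarrow> ('r, 'a, 'm) module_scheme \<Rightarrow> ('a \<Rightarrow> 'a \<Rightarrow> 'r) \<Rightarrow>
    ('a, 'b, 'n) module_scheme \<Rightarrow> 'r"
  where "form_index R A \<beta> M = central_character R A M (character_element R A \<beta> M)"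

definition character_idempotent ::
  "('r, 'k) ring_scheme \<Rightarrow> ('r, 'a, 'm) module_scheme \<Rightarrow> ('a \<Rightarrow> 'a \<Rightarrow> 'r) \<Rightarrow>
    ('a, 'b, 'n) module_scheme \<Rightarrow> 'a"
  where "character_idempotent R A \<beta> M =
    inv\<^bsub>R\<^esub> (form_index R A \<beta> M) \<odot>\<^bsub>A\<^esub> character_element R A \<beta> M"

end

theory Submission
  imports Defs
begin

text \<open>
  Fix dual bases \<open>x\<^sub>i, y\<^sub>i\<close> for \<open>\<beta>\<close>. Everything is expressed through the elements
  \<open>casimir c = \<Sum>\<^sub>i x\<^sub>i c y\<^sub>i\<close>, which are central for every \<open>c\<close> in \<open>A\<close> (\<open>casimir_central\<close>).

  The families \<open>x\<^sub>i\<close> and \<open>\<beta>(\<cdot>, y\<^sub>i)\<close> form a projective basis of \<open>A\<close> over \<open>R\<close>. Pushing it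
  forward along a linear projection gives projective bases of the summands \<open>Ae\<close> and
  \<open>e(M)A\<close> (\<open>projective_basis_of_retract\<close>), and a trace can be read off from any projective basis
  (\<open>trace_projective_basis\<close>). Hence \<open>\<chi>\<^sub>M(a) = \<Sum>\<^sub>i \<beta>(a x\<^sub>i e, y\<^sub>i) = \<beta>(a, casimir e)\<close>, that is
  \<open>z(M) = casimir e\<close>, and in the same way \<open>rank EA = \<beta>(E, casimir 1)\<close> for every idempotent \<open>E\<close>.

  Right multiplication by \<open>eae\<close> is an \<open>A\<close>-endomorphism of \<open>M = Ae\<close>, so \<open>End\<^sub>A(M) \<cong> R\<close> says that
  \<open>eAe = Re\<close>, freely over \<open>R\<close> (\<open>scalar_corner_of_scalar_endomorphisms\<close>). If \<open>eae = r e\<close>, applying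
  \<open>\<beta>(\<cdot>, 1)\<close> gives \<open>\<beta>(e, a) = r \<beta>(e, 1)\<close>, whence \<open>\<beta>(e, 1) eae = \<beta>(e, a) e\<close>. Therefore
  \<open>\<beta>(e, 1) z(M) e = \<Sum>\<^sub>i x\<^sub>i \<beta>(e, 1) e y\<^sub>i e = \<Sum>\<^sub>i \<beta>(e, y\<^sub>i) x\<^sub>i e = e e = e\<close>,
  and comparing with \<open>z(M) e = \<omega>\<^sub>M(z(M)) e\<close> yields (a).

  For (b), a central \<open>c\<close> can be moved next to \<open>e\<close> inside \<open>\<Sum>\<^sub>i x\<^sub>i e y\<^sub>i\<close>, where it acts as
  \<open>\<omega>\<^sub>M(c)\<close>; so \<open>c z(M) = \<omega>\<^sub>M(c) z(M)\<close>, and dividing by \<open>[A:M]\<^sub>\<beta>\<close> gives all the claims on \<open>e(M)\<close>.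
  For (c), with \<open>z = casimir 1\<close>, both sides equal \<open>\<beta>(z, z(M))\<close>.
\<close>

section \<open>Additive maps and finite sums\<close>

lemma additive_finsum:
  assumes M: "abelian_group M" and N: "abelian_group N"
    and closed: "f \<in> carrier M \<rightarrow> carrier N"
    and add: "\<And>x y. x \<in> carrier M \<Longrightarrow> y \<in> carrier M \<Longrightarrow> f (x \<oplus>\<^bsub>M\<^esub> y) = f x \<oplus>\<^bsub>N\<^esub> f y"
    and g: "g \<in> S \<rightarrow> carrier M" and S: "finite S"
  shows "f (\<Oplus>\<^bsub>M\<^esub>i\<in>S. g i) = (\<Oplus>\<^bsub>N\<^esub>i\<in>S. f (g i))"
proof -
  interpret M: abelian_group M by fact
  interpret N: abelian_group N by fact
  have zero: "f \<zero>\<^bsub>M\<^esub> = \<zero>\<^bsub>N\<^esub>"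
    using add[of "\<zero>\<^bsub>M\<^esub>" "\<zero>\<^bsub>M\<^esub>"] closed
    by (metis M.add.one_closed M.l_zero N.add.l_cancel_one' PiE)
  show ?thesis
    using S g
  proof induction
    case empty
    then show ?case by (simp add: zero)
  next
    case (insert i S)
    then have "g i \<in> carrier M" "g \<in> S \<rightarrow> carrier M" by auto
    moreover from this have "f (g i) \<in> carrier N" "(\<lambda>i. f (g i)) \<in> S \<rightarrow> carrier N"
      using closed by auto
    ultimately show ?case
      using insert by (simp add: add)
  qed
qed

lemma (in abelian_group) finsum_swap:
  assumes "finite S" "finite T" "\<And>i j. i \<in> S \<Longrightarrow> j \<in> T \<Longrightarrow> g i j \<in> carrier G"
  shows "(\<Oplus>i\<in>S. \<Oplus>j\<in>T. g i j) = (\<Oplus>j\<in>T. \<Oplus>i\<in>S. g i j)"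
  using assms(1,3)
proof induction
  case empty
  then show ?case by (simp add: finsum_zero)
next
  case (insert i S)
  have "(\<Oplus>j\<in>T. \<Oplus>i\<in>insert i S. g i j) = (\<Oplus>j\<in>T. g i j \<oplus> (\<Oplus>i\<in>S. g i j))"
    using insert by (intro finsum_cong') (auto intro!: finsum_closed)
  also have "\<dots> = (\<Oplus>j\<in>T. g i j) \<oplus> (\<Oplus>j\<in>T. \<Oplus>i\<in>S. g i j)"
    using insert by (intro finsum_addf) (auto intro!: finsum_closed)
  finally show ?case
    using insert by (simp add: Pi_def finsum_closed)
qed

lemma self_module_simps [simp]:
  "carrier (self_module A) = carrier A" "ring.add (self_module A) = ring.add A"
  "ring.zero (self_module A) = ring.zero A" "smult (self_module A) = monoid.mult A"
  "monoid.mult (self_module A) = monoid.mult A" "one (self_module A) = one A"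
  by (simp_all add: self_module_def)

lemma dual_module_carrier [simp]: "carrier (dual_module R N) = mod_hom R N (self_module R)"
  by (simp add: dual_module_def)

lemma mod_homD:
  assumes "f \<in> mod_hom R M N"
  shows "f \<in> carrier M \<rightarrow> carrier N"
    and "x \<in> carrier M \<Longrightarrow> f x \<in> carrier N"
    and "x \<in> carrier M \<Longrightarrow> y \<in> carrier M \<Longrightarrow> f (x \<oplus>\<^bsub>M\<^esub> y) = f x \<oplus>\<^bsub>N\<^esub> f y"
    and "r \<in> carrier R \<Longrightarrow> x \<in> carrier M \<Longrightarrow> f (r \<odot>\<^bsub>M\<^esub> x) = r \<odot>\<^bsub>N\<^esub> f x"
  using assms by (auto simp: mod_hom_def PiE_def)

lemma functional_lincomb:
  assumes "module R N" and f: "f \<in> mod_hom R N (self_module R)"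
    and S: "finite S" and r: "r \<in> S \<rightarrow> carrier R" and x: "x \<in> S \<rightarrow> carrier N"
  shows "f (\<Oplus>\<^bsub>N\<^esub>i\<in>S. r i \<odot>\<^bsub>N\<^esub> x i) = (\<Oplus>\<^bsub>R\<^esub>i\<in>S. r i \<otimes>\<^bsub>R\<^esub> f (x i))"
proof -
  interpret N: module R N by fact
  have "f (\<Oplus>\<^bsub>N\<^esub>i\<in>S. r i \<odot>\<^bsub>N\<^esub> x i) = (\<Oplus>\<^bsub>R\<^esub>i\<in>S. f (r i \<odot>\<^bsub>N\<^esub> x i))"
    using r x S mod_homD[OF f]
    by (intro additive_finsum N.M.abelian_group_axioms N.R.abelian_group_axioms) auto
  also have "\<dots> = (\<Oplus>\<^bsub>R\<^esub>i\<in>S. r i \<otimes>\<^bsub>R\<^esub> f (x i))"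
    using r x mod_homD[OF f] by (intro N.R.finsum_cong') (auto simp: Pi_def)
  finally show ?thesis .
qed

section \<open>Projective bases and traces\<close>

text \<open>
  The \<open>x\<^sub>i\<close> need not be a basis: the condition says that \<open>\<Sum>\<^sub>i x\<^sub>i \<otimes> \<phi>\<^sub>i\<close> represents the identity
  of \<open>N\<close>, as in the dual basis lemma.
\<close>

definition projective_basis ::
  "('r, 'k) ring_scheme \<Rightarrow> ('r, 'a, 'm) module_scheme \<Rightarrow> nat \<Rightarrow> (nat \<Rightarrow> 'a) \<Rightarrow> (nat \<Rightarrow> 'a \<Rightarrow> 'r) \<Rightarrow> bool"
  where "projective_basis R N n x \<phi> \<longleftrightarrow>
    x \<in> {1..n} \<rightarrow> carrier N \<and> \<phi> \<in> {1..n} \<rightarrow> carrier (dual_module R N) \<and>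
    (\<forall>v\<in>carrier N. v = (\<Oplus>\<^bsub>N\<^esub>i\<in>{1..n}. \<phi> i v \<odot>\<^bsub>N\<^esub> x i))"

text \<open>
  Expanding the vectors of one tensor representing \<open>f\<close> in a fixed projective basis turns its
  evaluation into \<open>\<Sum>\<^sub>i \<phi>\<^sub>i(f x\<^sub>i)\<close>, an expression that no longer mentions the tensor. This proves
  at once that the trace is well defined and computes it.
\<close>

lemma trace_projective_basis:
  assumes N: "module R N" and basis: "projective_basis R N n x \<phi>" and f: "f \<in> mod_hom R N N"
  shows "trace R N f = (\<Oplus>\<^bsub>R\<^esub>i\<in>{1..n}. \<phi> i (f (x i)))"
proof -
  interpret N: module R N by fact
  from basis have x: "x \<in> {1..n} \<rightarrow> carrier N"
    and \<phi>: "\<And>i. i \<in> {1..n} \<Longrightarrow> \<phi> i \<in> mod_hom R N (self_module R)"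
    and expand: "\<And>v. v \<in> carrier N \<Longrightarrow> v = (\<Oplus>\<^bsub>N\<^esub>i\<in>{1..n}. \<phi> i v \<odot>\<^bsub>N\<^esub> x i)"
    by (auto simp: projective_basis_def)
  have \<phi>_closed: "\<And>i v. i \<in> {1..n} \<Longrightarrow> v \<in> carrier N \<Longrightarrow> \<phi> i v \<in> carrier R"
    using mod_homD(2)[OF \<phi>] by simp
  note f_closed = mod_homD(2)[OF f]
  have x': "\<And>i. i \<in> {1..n} \<Longrightarrow> x i \<in> carrier N" using x by auto
  show ?thesis
    unfolding trace_def
  proof (rule the_equality)
    \<comment> \<open>Expanding \<open>f v\<close> in the projective basis represents \<open>f\<close> by the tensor
      \<open>\<Sum>\<^sub>i x\<^sub>i \<otimes> (\<phi>\<^sub>i \<circ> f)\<close>.\<close>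
    define \<psi> where "\<psi> = (\<lambda>i. \<lambda>v\<in>carrier N. \<phi> i (f v))"
    have "\<psi> \<in> {1..n} \<rightarrow> carrier (dual_module R N)"
      using mod_homD[OF f] mod_homD[OF \<phi>] by (auto simp: \<psi>_def mod_hom_def Pi_def)
    moreover have "f v = (\<Oplus>\<^bsub>N\<^esub>i\<in>{1..n}. \<psi> i v \<odot>\<^bsub>N\<^esub> x i)" if "v \<in> carrier N" for v
      using expand[OF f_closed[OF that]] that by (simp add: \<psi>_def)
    moreover have "(\<Oplus>\<^bsub>R\<^esub>i\<in>{1..n}. \<phi> i (f (x i))) = (\<Oplus>\<^bsub>R\<^esub>i\<in>{1..n}. \<psi> i (x i))"
      using x' \<phi>_closed f_closed by (intro N.R.finsum_cong') (auto simp: \<psi>_def Pi_def)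
    ultimately show "\<exists>(m::nat) u \<psi>. u \<in> {1..m} \<rightarrow> carrier N \<and> \<psi> \<in> {1..m} \<rightarrow> carrier (dual_module R N) \<and>
      (\<forall>v\<in>carrier N. f v = (\<Oplus>\<^bsub>N\<^esub>i\<in>{1..m}. \<psi> i v \<odot>\<^bsub>N\<^esub> u i)) \<and>
      (\<Oplus>\<^bsub>R\<^esub>i\<in>{1..n}. \<phi> i (f (x i))) = (\<Oplus>\<^bsub>R\<^esub>i\<in>{1..m}. \<psi> i (u i))"
      using x by (intro exI[of _ n] exI[of _ x] exI[of _ \<psi>]) simp
  next
    fix t
    assume "\<exists>(m::nat) u \<psi>. u \<in> {1..m} \<rightarrow> carrier N \<and> \<psi> \<in> {1..m} \<rightarrow> carrier (dual_module R N) \<and>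
      (\<forall>v\<in>carrier N. f v = (\<Oplus>\<^bsub>N\<^esub>i\<in>{1..m}. \<psi> i v \<odot>\<^bsub>N\<^esub> u i)) \<and>
      t = (\<Oplus>\<^bsub>R\<^esub>i\<in>{1..m}. \<psi> i (u i))"
    then obtain m :: nat and u \<psi> where "u \<in> {1..m} \<rightarrow> carrier N"
      and "\<psi> \<in> {1..m} \<rightarrow> carrier (dual_module R N)"
      and "\<forall>v\<in>carrier N. f v = (\<Oplus>\<^bsub>N\<^esub>j\<in>{1..m}. \<psi> j v \<odot>\<^bsub>N\<^esub> u j)"
      and t: "t = (\<Oplus>\<^bsub>R\<^esub>j\<in>{1..m}. \<psi> j (u j))"
      by (elim exE conjE)
    then have u: "\<And>j. j \<in> {1..m} \<Longrightarrow> u j \<in> carrier N"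
      and \<psi>: "\<And>j. j \<in> {1..m} \<Longrightarrow> \<psi> j \<in> mod_hom R N (self_module R)"
      and f_eq: "\<And>v. v \<in> carrier N \<Longrightarrow> f v = (\<Oplus>\<^bsub>N\<^esub>j\<in>{1..m}. \<psi> j v \<odot>\<^bsub>N\<^esub> u j)"
      by (auto simp del: One_nat_def)
    have \<psi>_closed: "\<And>j v. j \<in> {1..m} \<Longrightarrow> v \<in> carrier N \<Longrightarrow> \<psi> j v \<in> carrier R"
      using mod_homD(2)[OF \<psi>] by simp
    have "\<psi> j (u j) = (\<Oplus>\<^bsub>R\<^esub>i\<in>{1..n}. \<phi> i (u j) \<otimes>\<^bsub>R\<^esub> \<psi> j (x i))" if j: "j \<in> {1..m}" for j
    proof -
      have "\<psi> j (u j) = \<psi> j (\<Oplus>\<^bsub>N\<^esub>i\<in>{1..n}. \<phi> i (u j) \<odot>\<^bsub>N\<^esub> x i)"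
        by (rule arg_cong[OF expand[OF u[OF j]]])
      also have "\<dots> = (\<Oplus>\<^bsub>R\<^esub>i\<in>{1..n}. \<phi> i (u j) \<otimes>\<^bsub>R\<^esub> \<psi> j (x i))"
        using x u[OF j] \<phi>_closed by (intro functional_lincomb[OF N \<psi>[OF j]]) auto
      finally show ?thesis .
    qed
    then have "t = (\<Oplus>\<^bsub>R\<^esub>j\<in>{1..m}. \<Oplus>\<^bsub>R\<^esub>i\<in>{1..n}. \<phi> i (u j) \<otimes>\<^bsub>R\<^esub> \<psi> j (x i))"
      unfolding t using \<phi>_closed \<psi>_closed u x'
      by (intro N.R.finsum_cong') (auto intro!: N.R.finsum_closed)
    also have "\<dots> = (\<Oplus>\<^bsub>R\<^esub>i\<in>{1..n}. \<Oplus>\<^bsub>R\<^esub>j\<in>{1..m}. \<phi> i (u j) \<otimes>\<^bsub>R\<^esub> \<psi> j (x i))"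
      using \<phi>_closed \<psi>_closed u x' by (intro N.R.finsum_swap) auto
    also have "\<dots> = (\<Oplus>\<^bsub>R\<^esub>i\<in>{1..n}. \<phi> i (f (x i)))"
    proof (intro N.R.finsum_cong')
      fix i assume i: "i \<in> {1..n}"
      have "\<phi> i (f (x i)) = (\<Oplus>\<^bsub>R\<^esub>j\<in>{1..m}. \<psi> j (x i) \<otimes>\<^bsub>R\<^esub> \<phi> i (u j))"
        unfolding f_eq[OF x'[OF i]]
        using functional_lincomb[OF N \<phi>[OF i], of "{1..m}" "\<lambda>j. \<psi> j (x i)" u] u x'[OF i] \<psi>_closed
        by (simp add: Pi_def)
      also have "\<dots> = (\<Oplus>\<^bsub>R\<^esub>j\<in>{1..m}. \<phi> i (u j) \<otimes>\<^bsub>R\<^esub> \<psi> j (x i))"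
        using \<phi>_closed \<psi>_closed u x' i by (intro N.R.finsum_cong') (auto simp: N.R.m_comm)
      finally show "(\<Oplus>\<^bsub>R\<^esub>j\<in>{1..m}. \<phi> i (u j) \<otimes>\<^bsub>R\<^esub> \<psi> j (x i)) = \<phi> i (f (x i))" by simp
    qed (use \<phi>_closed f_closed x' in auto)
    finally show "t = (\<Oplus>\<^bsub>R\<^esub>i\<in>{1..n}. \<phi> i (f (x i)))" .
  qed
qed

lemma free_module_simps [simp]:
  "carrier (free_module R n) = {1..n} \<rightarrow>\<^sub>E carrier R"
  "ring.add (free_module R n) = (\<lambda>v w. \<lambda>i\<in>{1..n}. v i \<oplus>\<^bsub>R\<^esub> w i)"
  "ring.zero (free_module R n) = (\<lambda>i\<in>{1..n}. \<zero>\<^bsub>R\<^esub>)"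
  "smult (free_module R n) = (\<lambda>r v. \<lambda>i\<in>{1..n}. r \<otimes>\<^bsub>R\<^esub> v i)"
  by (simp_all add: free_module_def)

text \<open>
  Let \<open>g\<close> identify \<open>N\<close> with the summand \<open>P\<close> of \<open>R\<^sup>n = P \<oplus> Q\<close>. The coordinates of \<open>g\<close> and the
  \<open>P\<close>-components \<open>p\<^sub>i\<close> of the standard basis vectors \<open>b\<^sub>i = p\<^sub>i + q\<^sub>i\<close> form a projective basis: for
  \<open>v\<close> in \<open>P\<close>, the difference \<open>v - \<Sum>\<^sub>i v\<^sub>i p\<^sub>i = \<Sum>\<^sub>i v\<^sub>i q\<^sub>i\<close> lies in \<open>P \<inter> Q = 0\<close>.
\<close>

lemma fg_projective_has_basis:
  assumes "fg_projective R N"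
  obtains n x \<phi> where "projective_basis R N n x \<phi>"
proof -
  from assms obtain n P Q g where N: "module R N"
    and P: "submodule P R (free_module R n)" and Q: "submodule Q R (free_module R n)"
    and PQ: "P \<inter> Q = {\<zero>\<^bsub>free_module R n\<^esub>}"
    and sum: "P <+>\<^bsub>free_module R n\<^esub> Q = carrier (free_module R n)"
    and g: "g \<in> mod_iso R N ((free_module R n)\<lparr>carrier := P\<rparr>)"
    unfolding fg_projective_def by blast
  interpret N: module R N by fact
  interpret P: submodule P R "free_module R n" by fact
  interpret Q: submodule Q R "free_module R n" by fact
  from g have ghom: "g \<in> mod_hom R N ((free_module R n)\<lparr>carrier := P\<rparr>)"
    and gbij: "bij_betw g (carrier N) P"
    by (auto simp: mod_iso_def)
  have g_closed: "\<And>v. v \<in> carrier N \<Longrightarrow> g v \<in> P"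
    using mod_homD(2)[OF ghom] by simp
  have P_sub: "P \<subseteq> {1..n} \<rightarrow>\<^sub>E carrier R" and Q_sub: "Q \<subseteq> {1..n} \<rightarrow>\<^sub>E carrier R"
    using P.subset Q.subset by simp_all
  have coord_closed: "v j \<in> carrier R" if "v \<in> P \<union> Q" "j \<in> {1..n}" for v j
    using that P_sub Q_sub by (auto simp: PiE_def Pi_def)
  define \<phi> where "\<phi> = (\<lambda>j. \<lambda>v\<in>carrier N. g v j)"
  have \<phi>: "\<phi> j \<in> mod_hom R N (self_module R)" if j: "j \<in> {1..n}" for j
    using j mod_homD(3,4)[OF ghom] coord_closed[OF _ j] g_closed
    by (auto simp: \<phi>_def mod_hom_def)
  define b where "b = (\<lambda>i. \<lambda>j\<in>{1..n}. if i = j then \<one>\<^bsub>R\<^esub> else \<zero>\<^bsub>R\<^esub>)"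
  have "\<exists>p q. p \<in> P \<and> q \<in> Q \<and> b i = (\<lambda>j\<in>{1..n}. p j \<oplus>\<^bsub>R\<^esub> q j)" for i
  proof -
    have "b i \<in> carrier (free_module R n)" by (auto simp: b_def)
    then show ?thesis unfolding sum[symmetric] set_add_def' by auto
  qed
  then obtain p q where p: "\<And>i. p i \<in> P" and q: "\<And>i. q i \<in> Q"
    and b: "\<And>i. b i = (\<lambda>j\<in>{1..n}. p i j \<oplus>\<^bsub>R\<^esub> q i j)"
    by metis
  define x where "x = (\<lambda>i. inv_into (carrier N) g (p i))"
  have x: "x i \<in> carrier N" and gx: "g (x i) = p i" for i
    using gbij p[of i] by (auto simp: x_def bij_betw_def inv_into_into f_inv_into_f)
  \<comment> \<open>Linear combinations of the \<open>q\<^sub>i\<close>, computed coordinatewise.\<close>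
  have Q_lincomb: "(\<lambda>j\<in>{1..n}. \<Oplus>\<^bsub>R\<^esub>i\<in>S. r i \<otimes>\<^bsub>R\<^esub> q i j) \<in> Q"
    if "finite S" "r \<in> S \<rightarrow> carrier R" for r :: "nat \<Rightarrow> 'a" and S
    using that
  proof induction
    case empty
    then show ?case using Q.one_closed by (simp add: restrict_def)
  next
    case (insert i S)
    have rq: "r i \<odot>\<^bsub>free_module R n\<^esub> q i \<in> Q"
      using Q.smult_closed q insert by auto
    have "(r i \<odot>\<^bsub>free_module R n\<^esub> q i) \<oplus>\<^bsub>free_module R n\<^esub> (\<lambda>j\<in>{1..n}. \<Oplus>\<^bsub>R\<^esub>i\<in>S. r i \<otimes>\<^bsub>R\<^esub> q i j) \<in> Q"
      using Q.m_closed[OF rq] insert by simp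
    moreover have "(r i \<odot>\<^bsub>free_module R n\<^esub> q i) \<oplus>\<^bsub>free_module R n\<^esub>
        (\<lambda>j\<in>{1..n}. \<Oplus>\<^bsub>R\<^esub>i\<in>S. r i \<otimes>\<^bsub>R\<^esub> q i j) = (\<lambda>j\<in>{1..n}. \<Oplus>\<^bsub>R\<^esub>i\<in>insert i S. r i \<otimes>\<^bsub>R\<^esub> q i j)"
      using insert q coord_closed by (auto simp: Pi_def intro!: restrict_ext)
    ultimately show ?case by (simp only:)
  qed
  have "v = (\<Oplus>\<^bsub>N\<^esub>i\<in>{1..n}. \<phi> i v \<odot>\<^bsub>N\<^esub> x i)" if v: "v \<in> carrier N" for v
  proof -
    define s where "s = (\<Oplus>\<^bsub>N\<^esub>i\<in>{1..n}. \<phi> i v \<odot>\<^bsub>N\<^esub> x i)"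
    have \<phi>v: "\<And>i. i \<in> {1..n} \<Longrightarrow> \<phi> i v \<in> carrier R"
      using mod_homD(2)[OF \<phi>] v by simp
    have s: "s \<in> carrier N"
      unfolding s_def using \<phi>v x by (auto intro!: N.M.finsum_closed)
    have "g (v \<ominus>\<^bsub>N\<^esub> s) j = (\<Oplus>\<^bsub>R\<^esub>i\<in>{1..n}. \<phi> i v \<otimes>\<^bsub>R\<^esub> q i j)" if j: "j \<in> {1..n}" for j
    proof -
      have pj: "\<And>i. p i j \<in> carrier R" and qj: "\<And>i. q i j \<in> carrier R"
        using p q coord_closed j by auto
      have sum_p: "\<phi> j s = (\<Oplus>\<^bsub>R\<^esub>i\<in>{1..n}. \<phi> i v \<otimes>\<^bsub>R\<^esub> p i j)"
      proof -
        have "\<phi> j s = (\<Oplus>\<^bsub>R\<^esub>i\<in>{1..n}. \<phi> i v \<otimes>\<^bsub>R\<^esub> \<phi> j (x i))"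
          unfolding s_def using \<phi>v x by (intro functional_lincomb[OF N \<phi>[OF j]]) auto
        then show ?thesis using x gx by (simp add: \<phi>_def)
      qed
      have "\<phi> j v = (\<Oplus>\<^bsub>R\<^esub>i\<in>{1..n}. if j = i then \<phi> i v else \<zero>\<^bsub>R\<^esub>)"
        using N.R.finsum_singleton[OF j, of "\<lambda>i. \<phi> i v"] \<phi>v by (simp add: Pi_def)
      also have "\<dots> = (\<Oplus>\<^bsub>R\<^esub>i\<in>{1..n}. \<phi> i v \<otimes>\<^bsub>R\<^esub> p i j \<oplus>\<^bsub>R\<^esub> \<phi> i v \<otimes>\<^bsub>R\<^esub> q i j)"
      proof (intro N.R.finsum_cong')
        fix i assume i: "i \<in> {1..n}"
        have "\<phi> i v \<otimes>\<^bsub>R\<^esub> p i j \<oplus>\<^bsub>R\<^esub> \<phi> i v \<otimes>\<^bsub>R\<^esub> q i j = \<phi> i v \<otimes>\<^bsub>R\<^esub> b i j"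
          using b[of i] j \<phi>v[OF i] pj qj by (simp add: N.R.r_distr)
        then show "(if j = i then \<phi> i v else \<zero>\<^bsub>R\<^esub>) = \<phi> i v \<otimes>\<^bsub>R\<^esub> p i j \<oplus>\<^bsub>R\<^esub> \<phi> i v \<otimes>\<^bsub>R\<^esub> q i j"
          using \<phi>v[OF i] j by (auto simp: b_def)
      qed (use \<phi>v pj qj in auto)
      also have "\<dots> = \<phi> j s \<oplus>\<^bsub>R\<^esub> (\<Oplus>\<^bsub>R\<^esub>i\<in>{1..n}. \<phi> i v \<otimes>\<^bsub>R\<^esub> q i j)"
        unfolding sum_p using \<phi>v pj qj by (intro N.R.finsum_addf) auto
      finally have eq: "\<phi> j v = \<phi> j s \<oplus>\<^bsub>R\<^esub> (\<Oplus>\<^bsub>R\<^esub>i\<in>{1..n}. \<phi> i v \<otimes>\<^bsub>R\<^esub> q i j)" .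
      have "\<phi> j v = \<phi> j (s \<oplus>\<^bsub>N\<^esub> (v \<ominus>\<^bsub>N\<^esub> s))"
        using v s by (metis N.M.a_comm N.M.add.inv_closed N.M.minus_eq N.M.r_neg1 N.M.a_assoc
          N.M.l_neg N.M.r_zero N.M.minus_closed)
      also have "\<dots> = \<phi> j s \<oplus>\<^bsub>R\<^esub> \<phi> j (v \<ominus>\<^bsub>N\<^esub> s)"
        using mod_homD(3)[OF \<phi>[OF j]] v s by simp
      finally have "\<phi> j (v \<ominus>\<^bsub>N\<^esub> s) = (\<Oplus>\<^bsub>R\<^esub>i\<in>{1..n}. \<phi> i v \<otimes>\<^bsub>R\<^esub> q i j)"
        using eq \<phi>v qj mod_homD(2)[OF \<phi>[OF j]] v s
        by (simp add: N.R.finsum_closed Pi_def)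
      then show ?thesis using v s by (simp add: \<phi>_def)
    qed
    moreover have gP: "g (v \<ominus>\<^bsub>N\<^esub> s) \<in> P" using g_closed v s by simp
    ultimately have "g (v \<ominus>\<^bsub>N\<^esub> s) = (\<lambda>j\<in>{1..n}. \<Oplus>\<^bsub>R\<^esub>i\<in>{1..n}. \<phi> i v \<otimes>\<^bsub>R\<^esub> q i j)"
      using P_sub by (intro extensionalityI[of _ "{1..n}"]) (auto simp: PiE_def simp del: One_nat_def)
    with Q_lincomb[of "{1..n}" "\<lambda>i. \<phi> i v"] \<phi>v have "g (v \<ominus>\<^bsub>N\<^esub> s) \<in> Q" by (simp add: Pi_def)
    with gP PQ have "g (v \<ominus>\<^bsub>N\<^esub> s) = (\<lambda>j\<in>{1..n}. \<zero>\<^bsub>R\<^esub>)" by auto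
    moreover have "g \<zero>\<^bsub>N\<^esub> = (\<lambda>j\<in>{1..n}. \<zero>\<^bsub>R\<^esub>)"
    proof -
      have "g \<zero>\<^bsub>N\<^esub> = g (\<zero>\<^bsub>R\<^esub> \<odot>\<^bsub>N\<^esub> \<zero>\<^bsub>N\<^esub>)" by simp
      also have "\<dots> = (\<lambda>j\<in>{1..n}. \<zero>\<^bsub>R\<^esub> \<otimes>\<^bsub>R\<^esub> g \<zero>\<^bsub>N\<^esub> j)"
        using mod_homD(4)[OF ghom N.R.zero_closed N.M.zero_closed] by simp
      also have "\<dots> = (\<lambda>j\<in>{1..n}. \<zero>\<^bsub>R\<^esub>)"
        using coord_closed g_closed[OF N.M.zero_closed] by (auto intro!: restrict_ext)
      finally show ?thesis .
    qed
    ultimately have "v \<ominus>\<^bsub>N\<^esub> s = \<zero>\<^bsub>N\<^esub>"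
      using gbij v s by (metis N.M.minus_closed N.M.zero_closed bij_betw_def inj_onD)
    then have "v = s"
      using v s by (metis N.M.add.inv_closed N.M.minus_eq N.M.minus_equality N.M.minus_minus)
    then show ?thesis unfolding s_def .
  qed
  then have "projective_basis R N n x \<phi>"
    using x \<phi> by (auto simp: projective_basis_def)
  then show thesis by (rule that)
qed

text \<open>
  The record \<open>N\<close> is arbitrary apart from its carrier and operations, so that the result applies
  both to a record obtained by restriction of scalars and to one obtained by shrinking the carrier
  of \<open>A\<close>.
\<close>

lemma projective_basis_of_retract:
  assumes A: "module R A" and basis: "projective_basis R A n x \<phi>"
    and p: "p \<in> mod_hom R A A" and idem: "\<And>a. a \<in> carrier A \<Longrightarrow> p (p a) = p a"
    and N: "carrier N = p ` carrier A" "ring.add N = ring.add A" "ring.zero N = ring.zero A"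
      "\<And>r v. r \<in> carrier R \<Longrightarrow> v \<in> carrier N \<Longrightarrow> r \<odot>\<^bsub>N\<^esub> v = r \<odot>\<^bsub>A\<^esub> v"
  shows "module R N" and "projective_basis R N n (\<lambda>i. p (x i)) (\<lambda>i. restrict (\<phi> i) (carrier N))"
proof -
  interpret A: module R A by fact
  note pD = mod_homD[OF p]
  have sub: "carrier N \<subseteq> carrier A" using pD N(1) by auto
  have fix_p: "p v = v" if "v \<in> carrier N" for v using that idem N(1) by auto
  have zero: "\<zero>\<^bsub>A\<^esub> \<in> carrier N" 
    using pD(4)[of "\<zero>\<^bsub>R\<^esub>" "\<zero>\<^bsub>A\<^esub>"] pD(2)[of "\<zero>\<^bsub>A\<^esub>"] by (auto simp: N(1) image_iff intro!: bexI[of _ "\<zero>\<^bsub>A\<^esub>"])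
  have add_closed: "u \<oplus>\<^bsub>A\<^esub> v \<in> carrier N" if "u \<in> carrier N" "v \<in> carrier N" for u v
    using that pD(3) N(1) sub fix_p by (metis A.M.add.m_closed image_eqI subset_iff)
  have smult_closed: "r \<odot>\<^bsub>A\<^esub> v \<in> carrier N" if "r \<in> carrier R" "v \<in> carrier N" for r v
    using that pD(4) N(1) sub fix_p by (metis A.smult_closed image_eqI subset_iff)
  show mod: "module R N"
  proof (rule moduleI[OF A.R.cring_axioms])
    show "abelian_group N"
    proof (rule abelian_groupI)
      fix v assume v: "v \<in> carrier N"
      have "(\<ominus>\<^bsub>R\<^esub> \<one>\<^bsub>R\<^esub>) \<odot>\<^bsub>A\<^esub> v \<oplus>\<^bsub>A\<^esub> v = \<zero>\<^bsub>A\<^esub>"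
        using v sub A.smult_l_minus[of "\<one>\<^bsub>R\<^esub>" v] by (auto simp: A.M.l_neg)
      then show "\<exists>u\<in>carrier N. u \<oplus>\<^bsub>N\<^esub> v = \<zero>\<^bsub>N\<^esub>"
        using smult_closed[OF _ v, of "\<ominus>\<^bsub>R\<^esub> \<one>\<^bsub>R\<^esub>"] N(2,3) by auto
    qed (use N(2,3) sub zero add_closed in \<open>auto simp: A.M.add.m_ac subset_iff\<close>)
  qed (use N(2-4) sub smult_closed add_closed in
      \<open>auto simp: subset_iff A.smult_l_distr A.smult_r_distr A.smult_assoc1\<close>)
  interpret N: module R N by fact
  from basis have x: "\<And>i. i \<in> {1..n} \<Longrightarrow> x i \<in> carrier A"
    and \<phi>: "\<And>i. i \<in> {1..n} \<Longrightarrow> \<phi> i \<in> mod_hom R A (self_module R)"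
    and expand: "\<And>v. v \<in> carrier A \<Longrightarrow> v = (\<Oplus>\<^bsub>A\<^esub>i\<in>{1..n}. \<phi> i v \<odot>\<^bsub>A\<^esub> x i)"
    by (auto simp: projective_basis_def)
  have px: "\<And>i. i \<in> {1..n} \<Longrightarrow> p (x i) \<in> carrier N" using x N(1) by auto
  have \<phi>N: "restrict (\<phi> i) (carrier N) \<in> mod_hom R N (self_module R)" if i: "i \<in> {1..n}" for i
    using mod_homD[OF \<phi>[OF i]] sub add_closed smult_closed N(2-4)
    by (auto simp: mod_hom_def subset_iff)
  have "v = (\<Oplus>\<^bsub>N\<^esub>i\<in>{1..n}. restrict (\<phi> i) (carrier N) v \<odot>\<^bsub>N\<^esub> p (x i))" if v: "v \<in> carrier N" for v
  proof -
    have vA: "v \<in> carrier A" using v sub by auto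
    have \<phi>v: "\<And>i. i \<in> {1..n} \<Longrightarrow> \<phi> i v \<in> carrier R"
      using mod_homD(2)[OF \<phi>] vA by simp
    have "p (\<Oplus>\<^bsub>A\<^esub>i\<in>{1..n}. \<phi> i v \<odot>\<^bsub>A\<^esub> x i) = (\<Oplus>\<^bsub>N\<^esub>i\<in>{1..n}. p (\<phi> i v \<odot>\<^bsub>A\<^esub> x i))"
      using pD x \<phi>v N(1,2)
      by (intro additive_finsum A.M.abelian_group_axioms N.M.abelian_group_axioms) auto
    also have "\<dots> = (\<Oplus>\<^bsub>N\<^esub>i\<in>{1..n}. restrict (\<phi> i) (carrier N) v \<odot>\<^bsub>N\<^esub> p (x i))"
      using v \<phi>v px x pD(4) N(4) by (intro N.M.finsum_cong') auto
    finally show ?thesis using expand[OF vA] fix_p[OF v] by simp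
  qed
  then show "projective_basis R N n (\<lambda>i. p (x i)) (\<lambda>i. restrict (\<phi> i) (carrier N))"
    using px \<phi>N by (auto simp: projective_basis_def)
qed

section \<open>Symmetric algebras and dual bases\<close>

text \<open>
  The two-sided form covers one-sided multiplication by taking the other factor to be \<open>1\<close>; later
  proofs insert factors \<open>1\<close> for this purpose.
\<close>

lemma (in assoc_algebra) mult_lincomb:
  assumes S: "finite S" and r: "r \<in> S \<rightarrow> carrier R" and u: "u \<in> S \<rightarrow> carrier A"
    and a: "a \<in> carrier A" and b: "b \<in> carrier A"
  shows "a \<otimes>\<^bsub>A\<^esub> (\<Oplus>\<^bsub>A\<^esub>i\<in>S. r i \<odot>\<^bsub>A\<^esub> u i) \<otimes>\<^bsub>A\<^esub> b = (\<Oplus>\<^bsub>A\<^esub>i\<in>S. r i \<odot>\<^bsub>A\<^esub> (a \<otimes>\<^bsub>A\<^esub> u i \<otimes>\<^bsub>A\<^esub> b))"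
proof -
  have "a \<otimes>\<^bsub>A\<^esub> (\<Oplus>\<^bsub>A\<^esub>i\<in>S. r i \<odot>\<^bsub>A\<^esub> u i) \<otimes>\<^bsub>A\<^esub> b = (\<Oplus>\<^bsub>A\<^esub>i\<in>S. a \<otimes>\<^bsub>A\<^esub> (r i \<odot>\<^bsub>A\<^esub> u i) \<otimes>\<^bsub>A\<^esub> b)"
    using assms
    by (intro additive_finsum[of A A "\<lambda>v. a \<otimes>\<^bsub>A\<^esub> v \<otimes>\<^bsub>A\<^esub> b"] M.abelian_group_axioms)
      (auto simp: l_distr r_distr Pi_def)
  also have "\<dots> = (\<Oplus>\<^bsub>A\<^esub>i\<in>S. r i \<odot>\<^bsub>A\<^esub> (a \<otimes>\<^bsub>A\<^esub> u i \<otimes>\<^bsub>A\<^esub> b))"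
    using assms by (intro M.finsum_cong') (auto simp: smult_mult_left smult_mult_right Pi_def)
  finally show ?thesis .
qed

locale symmetric_algebra = assoc_algebra R A for R (structure) and A (structure) +
  fixes \<beta> :: "_ \<Rightarrow> _ \<Rightarrow> _"
  assumes bilinear: "bilinear_form R A \<beta>"
    and nonsingular: "nonsingular_form R A \<beta>"
    and associative: "associative_form A \<beta>"
    and symmetric: "symmetric_form A \<beta>"
begin

lemma form_functional: "b \<in> carrier A \<Longrightarrow> (\<lambda>a\<in>carrier A. \<beta> a b) \<in> mod_hom R A (self_module R)"
  using bilinear by (simp add: bilinear_form_def)

lemma form_closed [simp, intro]: "a \<in> carrier A \<Longrightarrow> b \<in> carrier A \<Longrightarrow> \<beta> a b \<in> carrier R"
  using mod_homD(2)[OF form_functional, of b a] by simp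

lemma form_assoc:
  "a \<in> carrier A \<Longrightarrow> b \<in> carrier A \<Longrightarrow> c \<in> carrier A \<Longrightarrow> \<beta> (a \<otimes>\<^bsub>A\<^esub> b) c = \<beta> a (b \<otimes>\<^bsub>A\<^esub> c)"
  using associative by (simp add: associative_form_def)

lemma form_sym: "a \<in> carrier A \<Longrightarrow> b \<in> carrier A \<Longrightarrow> \<beta> a b = \<beta> b a"
  using symmetric by (simp add: symmetric_form_def)

lemma form_smult_left:
  "r \<in> carrier R \<Longrightarrow> a \<in> carrier A \<Longrightarrow> b \<in> carrier A \<Longrightarrow> \<beta> (r \<odot>\<^bsub>A\<^esub> a) b = r \<otimes> \<beta> a b"
  using mod_homD(4)[OF form_functional, of b r a] by simp

lemma form_smult_right:
  "r \<in> carrier R \<Longrightarrow> a \<in> carrier A \<Longrightarrow> b \<in> carrier A \<Longrightarrow> \<beta> a (r \<odot>\<^bsub>A\<^esub> b) = r \<otimes> \<beta> a b"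
  by (metis form_sym form_smult_left smult_closed)

lemma form_finsum_right:
  assumes "finite S" "u \<in> S \<rightarrow> carrier A" "a \<in> carrier A"
  shows "\<beta> a (\<Oplus>\<^bsub>A\<^esub>i\<in>S. u i) = (\<Oplus>i\<in>S. \<beta> a (u i))"
proof (rule additive_finsum[OF M.abelian_group_axioms R.abelian_group_axioms])
  fix b c assume "b \<in> carrier A" "c \<in> carrier A"
  then show "\<beta> a (b \<oplus>\<^bsub>A\<^esub> c) = \<beta> a b \<oplus> \<beta> a c"
    using mod_homD(3)[OF form_functional[OF assms(3)], of b c] assms(3)
    by (simp add: form_sym[of a])
qed (use assms in auto)

lemma form_eqI:
  assumes "a \<in> carrier A" "b \<in> carrier A" "\<And>c. c \<in> carrier A \<Longrightarrow> \<beta> c a = \<beta> c b"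
  shows "a = b"
proof -
  have "inj_on (\<lambda>a\<in>carrier A. \<lambda>c\<in>carrier A. \<beta> a c) (carrier A)"
    using nonsingular by (auto simp: nonsingular_form_def mod_iso_def bij_betw_def)
  moreover have "(\<lambda>c\<in>carrier A. \<beta> a c) = (\<lambda>c\<in>carrier A. \<beta> b c)"
    using assms form_sym by (auto intro!: restrict_ext)
  ultimately show ?thesis using assms(1,2) by (auto dest: inj_onD)
qed

lemma functional_representable:
  assumes "\<phi> \<in> mod_hom R A (self_module R)"
  obtains w where "w \<in> carrier A" "\<And>a. a \<in> carrier A \<Longrightarrow> \<phi> a = \<beta> a w"
proof -
  have "\<phi> \<in> (\<lambda>a\<in>carrier A. \<lambda>c\<in>carrier A. \<beta> a c) ` carrier A"
    using nonsingular assms by (auto simp: nonsingular_form_def mod_iso_def bij_betw_def)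
  then show thesis using form_sym by (auto intro: that)
qed

lemma dual_bases_exist:
  assumes "fg_projective R A"
  obtains n x y where "dual_bases A \<beta> n x y"
proof -
  obtain n x \<phi> where basis: "projective_basis R A n x \<phi>"
    using fg_projective_has_basis[OF assms] by blast
  then have \<phi>: "\<And>i. i \<in> {1..n} \<Longrightarrow> \<phi> i \<in> mod_hom R A (self_module R)"
    by (auto simp: projective_basis_def)
  have "\<forall>i\<in>{1..n}. \<exists>w. w \<in> carrier A \<and> (\<forall>a\<in>carrier A. \<phi> i a = \<beta> a w)"
  proof
    fix i assume "i \<in> {1..n}"
    then show "\<exists>w. w \<in> carrier A \<and> (\<forall>a\<in>carrier A. \<phi> i a = \<beta> a w)"
      using functional_representable[OF \<phi>] by metis
  qed
  then obtain y where y: "\<And>i. i \<in> {1..n} \<Longrightarrow> y i \<in> carrier A"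
    and \<phi>_eq: "\<And>i a. i \<in> {1..n} \<Longrightarrow> a \<in> carrier A \<Longrightarrow> \<phi> i a = \<beta> a (y i)"
    by metis
  have x: "x \<in> {1..n} \<rightarrow> carrier A"
    using basis by (simp add: projective_basis_def)
  have "a = (\<Oplus>\<^bsub>A\<^esub>i\<in>{1..n}. \<beta> a (y i) \<odot>\<^bsub>A\<^esub> x i)" if a: "a \<in> carrier A" for a
  proof -
    have "a = (\<Oplus>\<^bsub>A\<^esub>i\<in>{1..n}. \<phi> i a \<odot>\<^bsub>A\<^esub> x i)"
      using basis a unfolding projective_basis_def by blast
    also have "\<dots> = (\<Oplus>\<^bsub>A\<^esub>i\<in>{1..n}. \<beta> a (y i) \<odot>\<^bsub>A\<^esub> x i)"
      using \<phi>_eq x y a by (intro M.finsum_cong') auto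
    finally show ?thesis .
  qed
  then have "dual_bases A \<beta> n x y"
    using x y unfolding dual_bases_def by blast
  then show thesis by (rule that)
qed

end

locale dual_bases_algebra = symmetric_algebra R A \<beta> for R (structure) and A (structure) and \<beta> +
  fixes n :: nat and x y :: "nat \<Rightarrow> _"
  assumes dual: "dual_bases A \<beta> n x y"
begin

lemma x_closed [simp, intro]: "i \<in> {1..n} \<Longrightarrow> x i \<in> carrier A"
  and y_closed [simp, intro]: "i \<in> {1..n} \<Longrightarrow> y i \<in> carrier A"
  using dual by (auto simp: dual_bases_def)

lemma expand_in_x: "a \<in> carrier A \<Longrightarrow> a = (\<Oplus>\<^bsub>A\<^esub>i\<in>{1..n}. \<beta> a (y i) \<odot>\<^bsub>A\<^esub> x i)"
  using dual unfolding dual_bases_def by blast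

text \<open>
  The right-hand side is what makes the roles of \<open>x\<^sub>i\<close> and \<open>y\<^sub>i\<close> interchangeable: by nondegeneracy
  it gives the expansion in the \<open>y\<^sub>i\<close>.
\<close>

lemma form_expand:
  assumes "a \<in> carrier A" "c \<in> carrier A"
  shows "\<beta> c a = (\<Oplus>i\<in>{1..n}. \<beta> c (y i) \<otimes> \<beta> a (x i))"
proof -
  have "\<beta> c a = \<beta> a (\<Oplus>\<^bsub>A\<^esub>i\<in>{1..n}. \<beta> c (y i) \<odot>\<^bsub>A\<^esub> x i)"
    using form_sym[OF assms(2,1)] arg_cong[OF expand_in_x[OF assms(2)], of "\<beta> a"] by (rule trans)
  also have "\<dots> = (\<Oplus>i\<in>{1..n}. \<beta> a (\<beta> c (y i) \<odot>\<^bsub>A\<^esub> x i))"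
    using assms by (intro form_finsum_right) auto
  also have "\<dots> = (\<Oplus>i\<in>{1..n}. \<beta> c (y i) \<otimes> \<beta> a (x i))"
    using assms by (intro R.finsum_cong') (auto simp: form_smult_right)
  finally show ?thesis .
qed

lemma expand_in_y:
  assumes a: "a \<in> carrier A"
  shows "a = (\<Oplus>\<^bsub>A\<^esub>i\<in>{1..n}. \<beta> a (x i) \<odot>\<^bsub>A\<^esub> y i)"
proof (rule form_eqI[OF a])
  show "(\<Oplus>\<^bsub>A\<^esub>i\<in>{1..n}. \<beta> a (x i) \<odot>\<^bsub>A\<^esub> y i) \<in> carrier A"
    using a by (intro M.finsum_closed) auto
  fix c assume c: "c \<in> carrier A"
  have "\<beta> c (\<Oplus>\<^bsub>A\<^esub>i\<in>{1..n}. \<beta> a (x i) \<odot>\<^bsub>A\<^esub> y i) = (\<Oplus>i\<in>{1..n}. \<beta> c (\<beta> a (x i) \<odot>\<^bsub>A\<^esub> y i))"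
    using a c by (intro form_finsum_right) auto
  also have "\<dots> = (\<Oplus>i\<in>{1..n}. \<beta> c (y i) \<otimes> \<beta> a (x i))"
    using a c by (intro R.finsum_cong') (auto simp: form_smult_right R.m_comm)
  finally show "\<beta> c a = \<beta> c (\<Oplus>\<^bsub>A\<^esub>i\<in>{1..n}. \<beta> a (x i) \<odot>\<^bsub>A\<^esub> y i)"
    using form_expand[OF a c] by simp
qed

lemma projective_basis_dual: "projective_basis R A n x (\<lambda>i. \<lambda>a\<in>carrier A. \<beta> a (y i))"
proof -
  have "a = (\<Oplus>\<^bsub>A\<^esub>i\<in>{1..n}. (\<lambda>a\<in>carrier A. \<beta> a (y i)) a \<odot>\<^bsub>A\<^esub> x i)" if a: "a \<in> carrier A" for a
    by (subst restrict_apply', rule a, rule expand_in_x[OF a])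
  then show ?thesis
    unfolding projective_basis_def using form_functional by auto
qed

text \<open>
  The image of \<open>\<Sum>\<^sub>i x\<^sub>i \<otimes> y\<^sub>i\<close> under \<open>a \<otimes> b \<mapsto> a c b\<close>. At \<open>c = 1\<close> it is \<open>z\<^sub>\<beta>\<close>; at an idempotent
  \<open>e\<close> it is the element representing the character of \<open>Ae\<close>.
\<close>

definition casimir where "casimir c = (\<Oplus>\<^bsub>A\<^esub>i\<in>{1..n}. x i \<otimes>\<^bsub>A\<^esub> c \<otimes>\<^bsub>A\<^esub> y i)"

lemma casimir_closed [simp, intro]: "c \<in> carrier A \<Longrightarrow> casimir c \<in> carrier A"
  unfolding casimir_def by (intro M.finsum_closed) auto

lemma form_casimir:
  assumes "a \<in> carrier A" "c \<in> carrier A"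
  shows "\<beta> a (casimir c) = (\<Oplus>i\<in>{1..n}. \<beta> (a \<otimes>\<^bsub>A\<^esub> x i \<otimes>\<^bsub>A\<^esub> c) (y i))"
proof -
  have "\<beta> a (casimir c) = (\<Oplus>i\<in>{1..n}. \<beta> a (x i \<otimes>\<^bsub>A\<^esub> c \<otimes>\<^bsub>A\<^esub> y i))"
    unfolding casimir_def using assms by (intro form_finsum_right) auto
  also have "\<dots> = (\<Oplus>i\<in>{1..n}. \<beta> (a \<otimes>\<^bsub>A\<^esub> x i \<otimes>\<^bsub>A\<^esub> c) (y i))"
    using assms by (intro R.finsum_cong') (auto simp: form_assoc m_assoc)
  finally show ?thesis .
qed

lemma mult_casimir:
  assumes a: "a \<in> carrier A" and b: "b \<in> carrier A" and c: "c \<in> carrier A"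
  shows "a \<otimes>\<^bsub>A\<^esub> casimir c \<otimes>\<^bsub>A\<^esub> b = (\<Oplus>\<^bsub>A\<^esub>i\<in>{1..n}. a \<otimes>\<^bsub>A\<^esub> x i \<otimes>\<^bsub>A\<^esub> c \<otimes>\<^bsub>A\<^esub> y i \<otimes>\<^bsub>A\<^esub> b)"
proof -
  have "a \<otimes>\<^bsub>A\<^esub> casimir c \<otimes>\<^bsub>A\<^esub> b = (\<Oplus>\<^bsub>A\<^esub>i\<in>{1..n}. a \<otimes>\<^bsub>A\<^esub> (x i \<otimes>\<^bsub>A\<^esub> c \<otimes>\<^bsub>A\<^esub> y i) \<otimes>\<^bsub>A\<^esub> b)"
    unfolding casimir_def using assms
    by (intro additive_finsum[of A A "\<lambda>v. a \<otimes>\<^bsub>A\<^esub> v \<otimes>\<^bsub>A\<^esub> b"] M.abelian_group_axioms)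
      (auto simp: l_distr r_distr)
  also have "\<dots> = (\<Oplus>\<^bsub>A\<^esub>i\<in>{1..n}. a \<otimes>\<^bsub>A\<^esub> x i \<otimes>\<^bsub>A\<^esub> c \<otimes>\<^bsub>A\<^esub> y i \<otimes>\<^bsub>A\<^esub> b)"
    using assms by (intro M.finsum_cong') (auto simp: m_assoc)
  finally show ?thesis .
qed

text \<open>
  This is the identity \<open>\<Sum>\<^sub>i b x\<^sub>i \<otimes> y\<^sub>i = \<Sum>\<^sub>j x\<^sub>j \<otimes> y\<^sub>j b\<close>. Expanding \<open>b x\<^sub>i\<close> in the \<open>x\<^sub>j\<close> produces
  the coefficients \<open>\<beta>(b x\<^sub>i, y\<^sub>j)\<close>; associativity and symmetry rewrite them as \<open>\<beta>(y\<^sub>j b, x\<^sub>i)\<close>, the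
  coefficients of \<open>y\<^sub>j b\<close> in the \<open>y\<^sub>i\<close>. In the proof, \<open>t i j\<close> is the common summand.
\<close>

lemma casimir_central:
  assumes c: "c \<in> carrier A"
  shows "casimir c \<in> center A"
proof -
  have "b \<otimes>\<^bsub>A\<^esub> casimir c = casimir c \<otimes>\<^bsub>A\<^esub> b" if b: "b \<in> carrier A" for b
  proof -
    define t where "t = (\<lambda>i j. \<beta> (b \<otimes>\<^bsub>A\<^esub> x i) (y j) \<odot>\<^bsub>A\<^esub> (x j \<otimes>\<^bsub>A\<^esub> c \<otimes>\<^bsub>A\<^esub> y i))"
    have t: "t i j \<in> carrier A" if "i \<in> {1..n}" "j \<in> {1..n}" for i j
      using that b c by (auto simp: t_def simp del: atLeastAtMost_iff)
    have row: "b \<otimes>\<^bsub>A\<^esub> x i \<otimes>\<^bsub>A\<^esub> c \<otimes>\<^bsub>A\<^esub> y i = (\<Oplus>\<^bsub>A\<^esub>j\<in>{1..n}. t i j)" if i: "i \<in> {1..n}" for i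
    proof -
      have bx: "b \<otimes>\<^bsub>A\<^esub> x i \<in> carrier A" using b x_closed[OF i] by simp
      have "b \<otimes>\<^bsub>A\<^esub> x i \<otimes>\<^bsub>A\<^esub> c \<otimes>\<^bsub>A\<^esub> y i = \<one>\<^bsub>A\<^esub> \<otimes>\<^bsub>A\<^esub> (b \<otimes>\<^bsub>A\<^esub> x i) \<otimes>\<^bsub>A\<^esub> (c \<otimes>\<^bsub>A\<^esub> y i)"
        using b c x_closed[OF i] y_closed[OF i] by (simp add: m_assoc)
      also have "\<dots> = \<one>\<^bsub>A\<^esub> \<otimes>\<^bsub>A\<^esub> (\<Oplus>\<^bsub>A\<^esub>j\<in>{1..n}. \<beta> (b \<otimes>\<^bsub>A\<^esub> x i) (y j) \<odot>\<^bsub>A\<^esub> x j) \<otimes>\<^bsub>A\<^esub> (c \<otimes>\<^bsub>A\<^esub> y i)"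
        by (rule arg_cong[OF expand_in_x[OF bx], of "\<lambda>v. \<one>\<^bsub>A\<^esub> \<otimes>\<^bsub>A\<^esub> v \<otimes>\<^bsub>A\<^esub> (c \<otimes>\<^bsub>A\<^esub> y i)"])
      also have "\<dots> = (\<Oplus>\<^bsub>A\<^esub>j\<in>{1..n}. \<beta> (b \<otimes>\<^bsub>A\<^esub> x i) (y j) \<odot>\<^bsub>A\<^esub> (\<one>\<^bsub>A\<^esub> \<otimes>\<^bsub>A\<^esub> x j \<otimes>\<^bsub>A\<^esub> (c \<otimes>\<^bsub>A\<^esub> y i)))"
        using bx c y_closed[OF i] by (intro mult_lincomb) auto
      also have "\<dots> = (\<Oplus>\<^bsub>A\<^esub>j\<in>{1..n}. t i j)"
        using t[OF i] c y_closed[OF i] by (intro M.finsum_cong') (auto simp: t_def m_assoc)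
      finally show ?thesis .
    qed
    have column: "(\<Oplus>\<^bsub>A\<^esub>i\<in>{1..n}. t i j) = x j \<otimes>\<^bsub>A\<^esub> c \<otimes>\<^bsub>A\<^esub> y j \<otimes>\<^bsub>A\<^esub> b" if j: "j \<in> {1..n}" for j
    proof -
      have yb: "y j \<otimes>\<^bsub>A\<^esub> b \<in> carrier A" and xc: "x j \<otimes>\<^bsub>A\<^esub> c \<in> carrier A"
        using b c x_closed[OF j] y_closed[OF j] by simp_all
      have "\<beta> (b \<otimes>\<^bsub>A\<^esub> x i) (y j) = \<beta> (y j \<otimes>\<^bsub>A\<^esub> b) (x i)" if i: "i \<in> {1..n}" for i
        using form_sym[of "b \<otimes>\<^bsub>A\<^esub> x i" "y j"] form_assoc[of "y j" b "x i"]
          b x_closed[OF i] y_closed[OF j] by simp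
      then have "(\<Oplus>\<^bsub>A\<^esub>i\<in>{1..n}. t i j) =
          (\<Oplus>\<^bsub>A\<^esub>i\<in>{1..n}. \<beta> (y j \<otimes>\<^bsub>A\<^esub> b) (x i) \<odot>\<^bsub>A\<^esub> (x j \<otimes>\<^bsub>A\<^esub> c \<otimes>\<^bsub>A\<^esub> y i \<otimes>\<^bsub>A\<^esub> \<one>\<^bsub>A\<^esub>))"
        using xc yb by (intro M.finsum_cong') (auto simp: t_def)
      also have "\<dots> = (x j \<otimes>\<^bsub>A\<^esub> c) \<otimes>\<^bsub>A\<^esub> (\<Oplus>\<^bsub>A\<^esub>i\<in>{1..n}. \<beta> (y j \<otimes>\<^bsub>A\<^esub> b) (x i) \<odot>\<^bsub>A\<^esub> y i) \<otimes>\<^bsub>A\<^esub> \<one>\<^bsub>A\<^esub>"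
        using xc yb by (intro mult_lincomb[symmetric]) auto
      also have "\<dots> = (x j \<otimes>\<^bsub>A\<^esub> c) \<otimes>\<^bsub>A\<^esub> (y j \<otimes>\<^bsub>A\<^esub> b) \<otimes>\<^bsub>A\<^esub> \<one>\<^bsub>A\<^esub>"
        by (rule arg_cong[OF expand_in_y[OF yb], of "\<lambda>v. (x j \<otimes>\<^bsub>A\<^esub> c) \<otimes>\<^bsub>A\<^esub> v \<otimes>\<^bsub>A\<^esub> \<one>\<^bsub>A\<^esub>", symmetric])
      finally show ?thesis
        using b c x_closed[OF j] y_closed[OF j] by (simp add: m_assoc)
    qed
    have "b \<otimes>\<^bsub>A\<^esub> casimir c = (\<Oplus>\<^bsub>A\<^esub>i\<in>{1..n}. b \<otimes>\<^bsub>A\<^esub> x i \<otimes>\<^bsub>A\<^esub> c \<otimes>\<^bsub>A\<^esub> y i \<otimes>\<^bsub>A\<^esub> \<one>\<^bsub>A\<^esub>)"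
      using mult_casimir[OF b one_closed c] b c by simp
    also have "\<dots> = (\<Oplus>\<^bsub>A\<^esub>i\<in>{1..n}. \<Oplus>\<^bsub>A\<^esub>j\<in>{1..n}. t i j)"
      using row t b c by (intro M.finsum_cong') (auto intro!: M.finsum_closed)
    also have "\<dots> = (\<Oplus>\<^bsub>A\<^esub>j\<in>{1..n}. \<Oplus>\<^bsub>A\<^esub>i\<in>{1..n}. t i j)"
      using t by (intro M.finsum_swap) auto
    also have "\<dots> = (\<Oplus>\<^bsub>A\<^esub>j\<in>{1..n}. \<one>\<^bsub>A\<^esub> \<otimes>\<^bsub>A\<^esub> x j \<otimes>\<^bsub>A\<^esub> c \<otimes>\<^bsub>A\<^esub> y j \<otimes>\<^bsub>A\<^esub> b)"
      using column b c by (intro M.finsum_cong') auto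
    also have "\<dots> = casimir c \<otimes>\<^bsub>A\<^esub> b"
      using mult_casimir[OF one_closed b c] b c by simp
    finally show ?thesis .
  qed
  then show ?thesis using c by (simp add: center_def)
qed

end

section \<open>Idempotents with scalar corner\<close>

lemma principal_left_module_carrier:
  "carrier (principal_left_module A e) = (\<lambda>a. a \<otimes>\<^bsub>A\<^esub> e) ` carrier A"
  by (simp add: principal_left_module_def)

lemma principal_left_module_simps [simp]:
  "ring.add (principal_left_module A e) = ring.add A"
  "ring.zero (principal_left_module A e) = ring.zero A"
  "smult (principal_left_module A e) = monoid.mult A"
  by (simp_all add: principal_left_module_def)

lemma restrict_scalars_simps [simp]:
  "carrier (restrict_scalars A M) = carrier M"
  "ring.add (restrict_scalars A M) = ring.add M"
  "ring.zero (restrict_scalars A M) = ring.zero M"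
  by (simp_all add: restrict_scalars_def)

context assoc_algebra
begin

lemma centerD: "c \<in> center A \<Longrightarrow> c \<in> carrier A"
  "c \<in> center A \<Longrightarrow> a \<in> carrier A \<Longrightarrow> c \<otimes>\<^bsub>A\<^esub> a = a \<otimes>\<^bsub>A\<^esub> c"
  by (auto simp: center_def)

lemma smult_restrict_scalars_principal:
  assumes "r \<in> carrier R" "v \<in> carrier A"
  shows "r \<odot>\<^bsub>restrict_scalars A (principal_left_module A e)\<^esub> v = r \<odot>\<^bsub>A\<^esub> v"
  using assms by (simp add: restrict_scalars_def smult_mult_left)

lemma principal_left_module_iff:
  assumes "e \<in> carrier A" "e \<otimes>\<^bsub>A\<^esub> e = e"
  shows "v \<in> carrier (principal_left_module A e) \<longleftrightarrow> v \<in> carrier A \<and> v \<otimes>\<^bsub>A\<^esub> e = v"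
  using assms by (auto simp: principal_left_module_carrier m_assoc image_iff intro: bexI[of _ v])

text \<open>
  An algebra isomorphism \<open>h\<close> onto \<open>R\<close> sends the homothety by \<open>r\<close> to \<open>r h(1) = r\<close>. Injectivity of
  \<open>h\<close> makes every endomorphism \<open>f\<close> the homothety by \<open>h f\<close>; applied to \<open>v \<mapsto> v a e\<close> and evaluated at
  \<open>e\<close> this is the first claim. For the second, \<open>r e = s e\<close> makes the homotheties by \<open>r\<close> and \<open>s\<close>
  agree on \<open>Ae\<close>.
\<close>

lemma scalar_corner_of_scalar_endomorphisms:
  assumes e: "e \<in> carrier A" and idem: "e \<otimes>\<^bsub>A\<^esub> e = e"
    and iso: "alg_isomorphic R (End_alg A (principal_left_module A e)) (self_module R)"
  shows "a \<in> carrier A \<Longrightarrow> \<exists>r\<in>carrier R. e \<otimes>\<^bsub>A\<^esub> a \<otimes>\<^bsub>A\<^esub> e = r \<odot>\<^bsub>A\<^esub> e"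
    and "r \<in> carrier R \<Longrightarrow> s \<in> carrier R \<Longrightarrow> r \<odot>\<^bsub>A\<^esub> e = s \<odot>\<^bsub>A\<^esub> e \<Longrightarrow> r = s"
proof -
  let ?M = "principal_left_module A e"
  let ?E = "End_alg A ?M"
  have E: "carrier ?E = mod_hom A ?M ?M" "\<one>\<^bsub>?E\<^esub> = (\<lambda>v\<in>carrier ?M. v)"
    by (simp_all add: End_alg_def)
  note M_iff = principal_left_module_iff[OF e idem]
  have eM: "e \<in> carrier ?M" using M_iff e idem by blast
  from iso obtain h where h: "h \<in> ring_iso ?E (self_module R)" "h \<in> mod_hom R ?E (self_module R)"
    unfolding alg_isomorphic_def by blast
  have inj: "inj_on h (mod_hom A ?M ?M)"
    using ring_iso_memE(5)[OF h(1)] E by (auto simp: bij_betw_def)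
  have one: "h \<one>\<^bsub>?E\<^esub> = \<one>"
    using ring_iso_memE(4)[OF h(1)] by simp
  have one_E: "\<one>\<^bsub>?E\<^esub> \<in> carrier ?E"
    unfolding E mod_hom_def using M_iff by (auto simp: l_distr m_assoc e idem)
  define scal where "scal = (\<lambda>r. \<lambda>v\<in>carrier ?M. r \<odot>\<^bsub>A\<^esub> v)"
  have smult_one: "r \<odot>\<^bsub>?E\<^esub> \<one>\<^bsub>?E\<^esub> = scal r" if "r \<in> carrier R" for r
    unfolding scal_def E(2) End_alg_def using that
    by (auto intro!: restrict_ext simp: smult_restrict_scalars_principal M_iff)
  have h_scal: "h (scal r) = r" if r: "r \<in> carrier R" for r
    using mod_homD(4)[OF h(2) r one_E] one smult_one[OF r] r by simp
  have scal_E: "scal r \<in> mod_hom A ?M ?M" if "r \<in> carrier R" for r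
    using that unfolding mod_hom_def scal_def
    by (auto simp: smult_mult_left smult_mult_right smult_r_distr e M_iff l_distr m_assoc)
  show "\<exists>r\<in>carrier R. e \<otimes>\<^bsub>A\<^esub> a \<otimes>\<^bsub>A\<^esub> e = r \<odot>\<^bsub>A\<^esub> e" if a: "a \<in> carrier A"
  proof -
    define f where "f = (\<lambda>v\<in>carrier ?M. v \<otimes>\<^bsub>A\<^esub> a \<otimes>\<^bsub>A\<^esub> e)"
    have f: "f \<in> mod_hom A ?M ?M"
      using a e idem unfolding mod_hom_def f_def
      by (auto simp: M_iff l_distr m_assoc)
    then have hf: "h f \<in> carrier R" using mod_homD(2)[OF h(2), of f] E by simp
    then have "h (scal (h f)) = h f" by (rule h_scal)
    then have "scal (h f) = f" using inj f scal_E[OF hf] by (auto dest: inj_onD)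
    then have "f e = h f \<odot>\<^bsub>A\<^esub> e" using eM by (metis restrict_apply' scal_def)
    then show ?thesis using hf eM f_def by auto
  qed
  show "r = s" if r: "r \<in> carrier R" and s: "s \<in> carrier R" and eq: "r \<odot>\<^bsub>A\<^esub> e = s \<odot>\<^bsub>A\<^esub> e"
  proof -
    have "r \<odot>\<^bsub>A\<^esub> v = s \<odot>\<^bsub>A\<^esub> v" if "v \<in> carrier ?M" for v
      using that smult_mult_right[OF r, of v e] smult_mult_right[OF s, of v e] e eq M_iff by metis
    then have "scal r = scal s" unfolding scal_def by (auto intro!: restrict_ext)
    then show ?thesis using h_scal r s by metis
  qed
qed

end

text \<open>
  The hypotheses on \<open>e\<close> are those that an isomorphism \<open>End\<^sub>A(Ae) \<cong> R\<close> provides: \<open>eAe\<close> is the free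
  \<open>R\<close>-module on \<open>e\<close>.
\<close>

locale scalar_corner_algebra = dual_bases_algebra R A \<beta> n x y
  for R (structure) and A (structure) and \<beta> n x y +
  fixes e
  assumes e_closed [simp, intro]: "e \<in> carrier A" and e_idem: "e \<otimes>\<^bsub>A\<^esub> e = e"
    and corner: "a \<in> carrier A \<Longrightarrow> \<exists>r\<in>carrier R. e \<otimes>\<^bsub>A\<^esub> a \<otimes>\<^bsub>A\<^esub> e = r \<odot>\<^bsub>A\<^esub> e"
    and corner_inj: "r \<in> carrier R \<Longrightarrow> s \<in> carrier R \<Longrightarrow> r \<odot>\<^bsub>A\<^esub> e = s \<odot>\<^bsub>A\<^esub> e \<Longrightarrow> r = s"
begin

abbreviation "M \<equiv> principal_left_module A e"
abbreviation "\<omega> \<equiv> central_character R A M"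

lemma module_iff: "v \<in> carrier M \<longleftrightarrow> v \<in> carrier A \<and> v \<otimes>\<^bsub>A\<^esub> e = v"
  by (rule principal_left_module_iff[OF e_closed e_idem])

text \<open>
  A central element acts on \<open>Ae\<close> by a scalar as soon as it does so on the generator \<open>e\<close>.
\<close>

lemma central_character_eqI:
  assumes c: "c \<in> center A" and r: "r \<in> carrier R" and eq: "c \<otimes>\<^bsub>A\<^esub> e = r \<odot>\<^bsub>A\<^esub> e"
  shows "\<omega> c = r"
  unfolding central_character_def
proof (rule the_equality)
  have "c \<otimes>\<^bsub>A\<^esub> v = r \<odot>\<^bsub>A\<^esub> v" if "v \<in> carrier M" for v
  proof -
    from that have v: "v \<in> carrier A" "v \<otimes>\<^bsub>A\<^esub> e = v" using module_iff by blast+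
    have "c \<otimes>\<^bsub>A\<^esub> v = v \<otimes>\<^bsub>A\<^esub> (c \<otimes>\<^bsub>A\<^esub> e)"
      using v c centerD[OF c] by (metis e_closed m_assoc)
    then show ?thesis using eq v r smult_mult_right[OF r v(1) e_closed] by simp
  qed
  then show "r \<in> carrier R \<and> (\<forall>v\<in>carrier M. c \<odot>\<^bsub>M\<^esub> v = r \<odot>\<^bsub>restrict_scalars A M\<^esub> v)"
    using r by (simp add: smult_restrict_scalars_principal module_iff del: principal_left_module_simps(1))
next
  fix s assume s: "s \<in> carrier R \<and> (\<forall>v\<in>carrier M. c \<odot>\<^bsub>M\<^esub> v = s \<odot>\<^bsub>restrict_scalars A M\<^esub> v)"
  have "e \<in> carrier M" using module_iff e_idem by blast
  with s have "c \<odot>\<^bsub>M\<^esub> e = s \<odot>\<^bsub>restrict_scalars A M\<^esub> e" by blast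
  then have "c \<otimes>\<^bsub>A\<^esub> e = s \<odot>\<^bsub>A\<^esub> e"
    using s smult_restrict_scalars_principal[of s e e] by simp
  then show "s = r" using corner_inj eq r s by metis
qed

lemma central_character:
  assumes c: "c \<in> center A"
  shows "\<omega> c \<in> carrier R" and "c \<otimes>\<^bsub>A\<^esub> e = \<omega> c \<odot>\<^bsub>A\<^esub> e"
proof -
  obtain r where r: "r \<in> carrier R" "e \<otimes>\<^bsub>A\<^esub> c \<otimes>\<^bsub>A\<^esub> e = r \<odot>\<^bsub>A\<^esub> e"
    using corner[OF centerD(1)[OF c]] by blast
  have "c \<otimes>\<^bsub>A\<^esub> e = e \<otimes>\<^bsub>A\<^esub> c \<otimes>\<^bsub>A\<^esub> e"
    using centerD[OF c] e_idem by (metis e_closed m_assoc)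
  with r central_character_eqI[OF c r(1)] show "\<omega> c \<in> carrier R" "c \<otimes>\<^bsub>A\<^esub> e = \<omega> c \<odot>\<^bsub>A\<^esub> e"
    by simp_all
qed

lemma projective_basis_module:
  shows "module R (restrict_scalars A M)"
    and "projective_basis R (restrict_scalars A M) n (\<lambda>i. (\<lambda>a\<in>carrier A. a \<otimes>\<^bsub>A\<^esub> e) (x i))
      (\<lambda>i. restrict (\<lambda>a\<in>carrier A. \<beta> a (y i)) (carrier (restrict_scalars A M)))"
proof -
  have p: "(\<lambda>a\<in>carrier A. a \<otimes>\<^bsub>A\<^esub> e) \<in> mod_hom R A A"
    by (auto simp: mod_hom_def l_distr smult_mult_left)
  have idem: "(\<lambda>a\<in>carrier A. a \<otimes>\<^bsub>A\<^esub> e) ((\<lambda>a\<in>carrier A. a \<otimes>\<^bsub>A\<^esub> e) a) = (\<lambda>a\<in>carrier A. a \<otimes>\<^bsub>A\<^esub> e) a"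
    if "a \<in> carrier A" for a
    using that by (simp add: m_assoc e_idem)
  note retract = projective_basis_of_retract[OF module_axioms projective_basis_dual p idem,
      of "restrict_scalars A M"]
  show "module R (restrict_scalars A M)"
    by (rule retract) (auto simp: principal_left_module_carrier smult_restrict_scalars_principal)
  show "projective_basis R (restrict_scalars A M) n (\<lambda>i. (\<lambda>a\<in>carrier A. a \<otimes>\<^bsub>A\<^esub> e) (x i))
      (\<lambda>i. restrict (\<lambda>a\<in>carrier A. \<beta> a (y i)) (carrier (restrict_scalars A M)))"
    by (rule retract) (auto simp: principal_left_module_carrier smult_restrict_scalars_principal)
qed

lemma character_eq_form:
  assumes a: "a \<in> carrier A"
  shows "character R A M a = \<beta> a (casimir e)"
proof -
  let ?f = "\<lambda>v\<in>carrier M. a \<odot>\<^bsub>M\<^esub> v"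
  have "?f \<in> mod_hom R (restrict_scalars A M) (restrict_scalars A M)"
    using a by (auto simp: mod_hom_def l_distr r_distr m_assoc module_iff smult_restrict_scalars_principal
        smult_mult_right smult_mult_left)
  then have "character R A M a = (\<Oplus>i\<in>{1..n}.
      restrict (\<lambda>a\<in>carrier A. \<beta> a (y i)) (carrier (restrict_scalars A M)) (?f ((\<lambda>a\<in>carrier A. a \<otimes>\<^bsub>A\<^esub> e) (x i))))"
    unfolding character_def by (rule trace_projective_basis[OF projective_basis_module])
  also have "\<dots> = (\<Oplus>i\<in>{1..n}. \<beta> (a \<otimes>\<^bsub>A\<^esub> x i \<otimes>\<^bsub>A\<^esub> e) (y i))"
    using a by (intro R.finsum_cong')
      (auto simp: module_iff e_idem m_assoc)
  also have "\<dots> = \<beta> a (casimir e)" using form_casimir[OF a e_closed] by simp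
  finally show ?thesis .
qed

lemma character_element: "character_element R A \<beta> M = casimir e"
  unfolding character_element_def
proof (rule the_equality)
  show "casimir e \<in> center A \<and> (\<forall>a\<in>carrier A. character R A M a = \<beta> a (casimir e))"
    using casimir_central character_eq_form by simp
  fix z assume "z \<in> center A \<and> (\<forall>a\<in>carrier A. character R A M a = \<beta> a z)"
  then show "z = casimir e"
    using character_eq_form centerD(1) by (intro form_eqI) auto
qed

lemma rank_module: "rank R (restrict_scalars A M) = \<beta> \<one>\<^bsub>A\<^esub> (casimir e)"
proof -
  have "rank R (restrict_scalars A M) = character R A M \<one>\<^bsub>A\<^esub>"
    unfolding rank_def character_def
    by (auto simp: module_iff intro!: arg_cong[where f = "trace R _"] restrict_ext)
  then show ?thesis by (simp add: character_eq_form)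
qed

text \<open>
  A central \<open>c\<close> slides past \<open>x\<^sub>i\<close> onto \<open>e\<close>, where it acts by \<open>\<omega>(c)\<close>.
\<close>

lemma center_mult_character_element:
  assumes c: "c \<in> center A"
  shows "c \<otimes>\<^bsub>A\<^esub> casimir e = \<omega> c \<odot>\<^bsub>A\<^esub> casimir e"
proof -
  note cA = centerD(1)[OF c]
  have "c \<otimes>\<^bsub>A\<^esub> casimir e = (\<Oplus>\<^bsub>A\<^esub>i\<in>{1..n}. c \<otimes>\<^bsub>A\<^esub> x i \<otimes>\<^bsub>A\<^esub> e \<otimes>\<^bsub>A\<^esub> y i \<otimes>\<^bsub>A\<^esub> \<one>\<^bsub>A\<^esub>)"
    using mult_casimir[OF cA one_closed e_closed] cA by simp
  also have "\<dots> = (\<Oplus>\<^bsub>A\<^esub>i\<in>{1..n}. \<omega> c \<odot>\<^bsub>A\<^esub> (x i \<otimes>\<^bsub>A\<^esub> e \<otimes>\<^bsub>A\<^esub> y i))"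
  proof (intro M.finsum_cong')
    fix i assume i: "i \<in> {1..n}"
    have "c \<otimes>\<^bsub>A\<^esub> x i \<otimes>\<^bsub>A\<^esub> e = x i \<otimes>\<^bsub>A\<^esub> (c \<otimes>\<^bsub>A\<^esub> e)"
      using centerD(2)[OF c x_closed[OF i]] cA x_closed[OF i] by (simp add: m_assoc)
    also have "\<dots> = \<omega> c \<odot>\<^bsub>A\<^esub> (x i \<otimes>\<^bsub>A\<^esub> e)"
      using central_character[OF c] smult_mult_right x_closed[OF i] by simp
    finally show "c \<otimes>\<^bsub>A\<^esub> x i \<otimes>\<^bsub>A\<^esub> e \<otimes>\<^bsub>A\<^esub> y i \<otimes>\<^bsub>A\<^esub> \<one>\<^bsub>A\<^esub> = \<omega> c \<odot>\<^bsub>A\<^esub> (x i \<otimes>\<^bsub>A\<^esub> e \<otimes>\<^bsub>A\<^esub> y i)"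
      using central_character(1)[OF c] x_closed[OF i] y_closed[OF i] by (simp add: smult_mult_left)
  qed (use central_character(1)[OF c] in auto)
  also have "\<dots> = \<omega> c \<odot>\<^bsub>A\<^esub> casimir e"
    unfolding casimir_def using central_character(1)[OF c]
    by (intro finsum_smult_ldistr[symmetric]) auto
  finally show ?thesis .
qed

text \<open>
  Writing \<open>eae = r e\<close>, the form detects the scalar up to the factor \<open>u = \<beta>(e, 1)\<close>, since
  \<open>\<beta>(e, a) = \<beta>(eae, 1) = r u\<close>. Hence \<open>u\<close> turns \<open>e y\<^sub>i e\<close> into \<open>\<beta>(e, y\<^sub>i) e\<close>, and the sum
  \<open>u \<Sum>\<^sub>i x\<^sub>i e y\<^sub>i e\<close> collapses to the dual basis expansion of \<open>e\<close>.
\<close>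

lemma form_e_inverse: "\<beta> e \<one>\<^bsub>A\<^esub> \<otimes> \<omega> (casimir e) = \<one>"
proof -
  define u where "u = \<beta> e \<one>\<^bsub>A\<^esub>"
  have u: "u \<in> carrier R" by (simp add: u_def)
  have corner_form: "u \<odot>\<^bsub>A\<^esub> (e \<otimes>\<^bsub>A\<^esub> a \<otimes>\<^bsub>A\<^esub> e) = \<beta> e a \<odot>\<^bsub>A\<^esub> e" if a: "a \<in> carrier A" for a
  proof -
    obtain r where r: "r \<in> carrier R" "e \<otimes>\<^bsub>A\<^esub> a \<otimes>\<^bsub>A\<^esub> e = r \<odot>\<^bsub>A\<^esub> e"
      using corner[OF a] by blast
    have "\<beta> e a = \<beta> (e \<otimes>\<^bsub>A\<^esub> e) a" by (simp add: e_idem)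
    also have "\<dots> = \<beta> (e \<otimes>\<^bsub>A\<^esub> a) e"
      using a by (simp add: form_assoc form_sym[of e "e \<otimes>\<^bsub>A\<^esub> a"])
    also have "\<dots> = \<beta> (e \<otimes>\<^bsub>A\<^esub> a \<otimes>\<^bsub>A\<^esub> e) \<one>\<^bsub>A\<^esub>"
      using a by (simp add: form_assoc)
    also have "\<dots> = r \<otimes> u" using r by (simp add: form_smult_left u_def)
    finally show ?thesis using r u by (simp add: smult_assoc1[symmetric] R.m_comm)
  qed
  have "(u \<otimes> \<omega> (casimir e)) \<odot>\<^bsub>A\<^esub> e = u \<odot>\<^bsub>A\<^esub> (casimir e \<otimes>\<^bsub>A\<^esub> e)"
    using u central_character[OF casimir_central[OF e_closed]] by (simp add: smult_assoc1)
  also have "\<dots> = u \<odot>\<^bsub>A\<^esub> (\<Oplus>\<^bsub>A\<^esub>i\<in>{1..n}. \<one>\<^bsub>A\<^esub> \<otimes>\<^bsub>A\<^esub> x i \<otimes>\<^bsub>A\<^esub> e \<otimes>\<^bsub>A\<^esub> y i \<otimes>\<^bsub>A\<^esub> e)"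
    using mult_casimir[OF one_closed e_closed e_closed] by simp
  also have "\<dots> = (\<Oplus>\<^bsub>A\<^esub>i\<in>{1..n}. u \<odot>\<^bsub>A\<^esub> (\<one>\<^bsub>A\<^esub> \<otimes>\<^bsub>A\<^esub> x i \<otimes>\<^bsub>A\<^esub> e \<otimes>\<^bsub>A\<^esub> y i \<otimes>\<^bsub>A\<^esub> e))"
    using u by (intro finsum_smult_ldistr) auto
  also have "\<dots> = (\<Oplus>\<^bsub>A\<^esub>i\<in>{1..n}. \<beta> e (y i) \<odot>\<^bsub>A\<^esub> (\<one>\<^bsub>A\<^esub> \<otimes>\<^bsub>A\<^esub> x i \<otimes>\<^bsub>A\<^esub> e))"
  proof (intro M.finsum_cong')
    fix i assume i: "i \<in> {1..n}"
    have "u \<odot>\<^bsub>A\<^esub> (x i \<otimes>\<^bsub>A\<^esub> (e \<otimes>\<^bsub>A\<^esub> y i \<otimes>\<^bsub>A\<^esub> e)) = x i \<otimes>\<^bsub>A\<^esub> (\<beta> e (y i) \<odot>\<^bsub>A\<^esub> e)"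
      using corner_form[OF y_closed[OF i]] smult_mult_right[OF u] x_closed[OF i] y_closed[OF i]
      by (metis e_closed m_closed)
    then show "u \<odot>\<^bsub>A\<^esub> (\<one>\<^bsub>A\<^esub> \<otimes>\<^bsub>A\<^esub> x i \<otimes>\<^bsub>A\<^esub> e \<otimes>\<^bsub>A\<^esub> y i \<otimes>\<^bsub>A\<^esub> e) = \<beta> e (y i) \<odot>\<^bsub>A\<^esub> (\<one>\<^bsub>A\<^esub> \<otimes>\<^bsub>A\<^esub> x i \<otimes>\<^bsub>A\<^esub> e)"
      using x_closed[OF i] y_closed[OF i] by (simp add: m_assoc smult_mult_right)
  qed auto
  also have "\<dots> = \<one>\<^bsub>A\<^esub> \<otimes>\<^bsub>A\<^esub> (\<Oplus>\<^bsub>A\<^esub>i\<in>{1..n}. \<beta> e (y i) \<odot>\<^bsub>A\<^esub> x i) \<otimes>\<^bsub>A\<^esub> e"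
    by (intro mult_lincomb[symmetric]) auto
  also have "\<dots> = \<one>\<^bsub>A\<^esub> \<otimes>\<^bsub>A\<^esub> e \<otimes>\<^bsub>A\<^esub> e"
    by (rule arg_cong[OF expand_in_x[OF e_closed], of "\<lambda>v. \<one>\<^bsub>A\<^esub> \<otimes>\<^bsub>A\<^esub> v \<otimes>\<^bsub>A\<^esub> e", symmetric])
  also have "\<dots> = \<one> \<odot>\<^bsub>A\<^esub> e" by (simp add: e_idem)
  finally show ?thesis
    using corner_inj[of "u \<otimes> \<omega> (casimir e)" \<one>] u
      central_character(1)[OF casimir_central[OF e_closed]] by (simp add: u_def)
qed

end

lemma (in dual_bases_algebra) rank_principal_right_ideal:
  assumes E: "E \<in> carrier A" "E \<otimes>\<^bsub>A\<^esub> E = E"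
  shows "rank R (principal_right_ideal A E) = \<beta> E (casimir \<one>\<^bsub>A\<^esub>)"
proof -
  let ?N = "principal_right_ideal A E" and ?p = "\<lambda>a\<in>carrier A. E \<otimes>\<^bsub>A\<^esub> a"
  have p: "?p \<in> mod_hom R A A"
    using E by (auto simp: mod_hom_def r_distr smult_mult_right)
  have idem: "?p (?p a) = ?p a" if "a \<in> carrier A" for a
    using that E by (simp add: m_assoc[symmetric])
  have N: "carrier ?N = ?p ` carrier A" "ring.add ?N = ring.add A" "ring.zero ?N = ring.zero A"
    "smult ?N = smult A"
    by (auto simp: principal_right_ideal_def)
  have basis: "module R ?N" "projective_basis R ?N n (\<lambda>i. ?p (x i))
      (\<lambda>i. restrict (\<lambda>a\<in>carrier A. \<beta> a (y i)) (carrier ?N))"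
    by (rule projective_basis_of_retract[OF module_axioms projective_basis_dual p idem N(1-3)]; simp add: N)+
  interpret N: module R ?N by (rule basis(1))
  have pN: "?p (x i) \<in> carrier ?N" if "i \<in> {1..n}" for i
    using that N(1) by blast
  have "rank R ?N = (\<Oplus>i\<in>{1..n}. restrict (\<lambda>a\<in>carrier A. \<beta> a (y i)) (carrier ?N)
      ((\<lambda>v\<in>carrier ?N. v) (?p (x i))))"
    unfolding rank_def
    by (rule trace_projective_basis[OF basis]) (auto simp: mod_hom_def)
  also have "\<dots> = (\<Oplus>i\<in>{1..n}. \<beta> (E \<otimes>\<^bsub>A\<^esub> x i \<otimes>\<^bsub>A\<^esub> \<one>\<^bsub>A\<^esub>) (y i))"
    using pN E by (intro R.finsum_cong') auto
  also have "\<dots> = \<beta> E (casimir \<one>\<^bsub>A\<^esub>)"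
    using form_casimir[OF E(1) one_closed] by simp
  finally show ?thesis .
qed

section \<open>The idempotent of the character and the rank formula\<close>

context scalar_corner_algebra
begin

lemma form_index: "form_index R A \<beta> M = \<omega> (casimir e)"
  by (simp add: form_index_def character_element)

lemma form_index_unit:
  "form_index R A \<beta> M \<in> Units R" "inv (form_index R A \<beta> M) = \<beta> e \<one>\<^bsub>A\<^esub>"
proof -
  have c: "\<omega> (casimir e) \<in> carrier R" by (rule central_character(1)[OF casimir_central[OF e_closed]])
  have "\<omega> (casimir e) \<otimes> \<beta> e \<one>\<^bsub>A\<^esub> = \<one>" using form_e_inverse c by (simp add: R.m_comm)
  then show "form_index R A \<beta> M \<in> Units R" "inv (form_index R A \<beta> M) = \<beta> e \<one>\<^bsub>A\<^esub>"
    using c form_e_inverse unfolding form_index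
    by (auto simp: Units_def intro!: R.comm_inv_char)
qed

lemma character_idempotent: "character_idempotent R A \<beta> M = \<beta> e \<one>\<^bsub>A\<^esub> \<odot>\<^bsub>A\<^esub> casimir e"
  by (simp add: character_idempotent_def form_index_unit character_element)

lemma character_idempotent_central: "character_idempotent R A \<beta> M \<in> center A"
  using casimir_central[OF e_closed] unfolding character_idempotent
  by (auto simp: center_def smult_mult_left smult_mult_right)

lemma center_mult_character_idempotent:
  assumes "c \<in> center A"
  shows "c \<otimes>\<^bsub>A\<^esub> character_idempotent R A \<beta> M = \<omega> c \<odot>\<^bsub>A\<^esub> character_idempotent R A \<beta> M"
  unfolding character_idempotent
  using center_mult_character_element[OF assms] centerD(1)[OF assms] central_character(1)[OF assms]
  by (simp add: smult_mult_right smult_assoc1[symmetric] R.m_comm)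

lemma central_character_character_idempotent: "\<omega> (character_idempotent R A \<beta> M) = \<one>"
proof (rule central_character_eqI[OF character_idempotent_central R.one_closed])
  have "character_idempotent R A \<beta> M \<otimes>\<^bsub>A\<^esub> e = \<beta> e \<one>\<^bsub>A\<^esub> \<odot>\<^bsub>A\<^esub> (casimir e \<otimes>\<^bsub>A\<^esub> e)"
    by (simp add: character_idempotent smult_mult_left)
  also have "\<dots> = (\<beta> e \<one>\<^bsub>A\<^esub> \<otimes> \<omega> (casimir e)) \<odot>\<^bsub>A\<^esub> e"
    using central_character[OF casimir_central[OF e_closed]] by (simp add: smult_assoc1)
  finally show "character_idempotent R A \<beta> M \<otimes>\<^bsub>A\<^esub> e = \<one> \<odot>\<^bsub>A\<^esub> e"
    by (simp add: form_e_inverse)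
qed

lemma character_idempotent_idem:
  "character_idempotent R A \<beta> M \<otimes>\<^bsub>A\<^esub> character_idempotent R A \<beta> M = character_idempotent R A \<beta> M"
  using center_mult_character_idempotent[OF character_idempotent_central]
    centerD(1)[OF character_idempotent_central]
  by (simp add: central_character_character_idempotent)

text \<open>
  Both sides equal \<open>\<beta>(z, z(M))\<close> for \<open>z = casimir 1\<close>: the left one because \<open>z z(M) = \<omega>(z) z(M)\<close>
  and \<open>rank M = \<beta>(1, z(M))\<close>, the right one because \<open>z(M) = [A:M]\<^sub>\<beta> e(M)\<close> and
  \<open>rank e(M)A = \<beta>(e(M), z)\<close>.
\<close>

lemma rank_formula:
  "\<omega> (casimir \<one>\<^bsub>A\<^esub>) \<otimes> rank R (restrict_scalars A M) =
    form_index R A \<beta> M \<otimes> rank R (principal_right_ideal A (character_idempotent R A \<beta> M))"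
proof -
  let ?z = "casimir \<one>\<^bsub>A\<^esub>" and ?E = "character_idempotent R A \<beta> M"
  have z: "?z \<in> center A" by (rule casimir_central) simp
  note zA = centerD(1)[OF z] and E = centerD(1)[OF character_idempotent_central]
  have c: "\<omega> (casimir e) \<in> carrier R" by (rule central_character(1)[OF casimir_central[OF e_closed]])
  have "\<omega> ?z \<otimes> rank R (restrict_scalars A M) = \<beta> \<one>\<^bsub>A\<^esub> (?z \<otimes>\<^bsub>A\<^esub> casimir e)"
    using central_character(1)[OF z]
    by (simp add: rank_module center_mult_character_element[OF z] form_smult_right)
  also have "\<dots> = \<beta> (casimir e) ?z"
    using form_assoc[of "\<one>\<^bsub>A\<^esub>" ?z "casimir e"] form_sym[of ?z "casimir e"] zA by simp
  also have "casimir e = (\<omega> (casimir e) \<otimes> \<beta> e \<one>\<^bsub>A\<^esub>) \<odot>\<^bsub>A\<^esub> casimir e"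
    using form_e_inverse c by (simp add: R.m_comm)
  also have "\<dots> = form_index R A \<beta> M \<odot>\<^bsub>A\<^esub> ?E"
    using c by (simp add: form_index character_idempotent smult_assoc1)
  also have "\<beta> (form_index R A \<beta> M \<odot>\<^bsub>A\<^esub> ?E) ?z = form_index R A \<beta> M \<otimes> \<beta> ?E ?z"
    using c E zA by (simp add: form_index form_smult_left)
  also have "\<beta> ?E ?z = rank R (principal_right_ideal A ?E)"
    by (rule rank_principal_right_ideal[OF E character_idempotent_idem, symmetric])
  finally show ?thesis .
qed

end

theorem proposition4:
  fixes R :: "('r, 'k) ring_scheme"
    and A :: "('r, 'a, 'm) module_scheme"
    and \<beta> :: "'a \<Rightarrow> 'a \<Rightarrow> 'r"
    and e :: 'a
    and M :: "('a, 'a) module"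
  assumes "cring R"
    and "assoc_algebra R A"
    and "fg_projective R A"
    and "bilinear_form R A \<beta>"
    and "nonsingular_form R A \<beta>"
    and "associative_form A \<beta>"
    and "symmetric_form A \<beta>"
    and "e \<in> carrier A"
    and "e \<otimes>\<^bsub>A\<^esub> e = e"
    and M_def: "M = principal_left_module A e"
    and "alg_isomorphic R (End_alg A M) (self_module R)"
  shows
    "(form_index R A \<beta> M \<in> Units R \<and>
      inv\<^bsub>R\<^esub> (form_index R A \<beta> M) = \<beta> e \<one>\<^bsub>A\<^esub>) \<and>
     (character_idempotent R A \<beta> M \<in> center A \<and>
      character_idempotent R A \<beta> M \<otimes>\<^bsub>A\<^esub> character_idempotent R A \<beta> M
        = character_idempotent R A \<beta> M \<and>
      central_character R A M (character_idempotent R A \<beta> M) = \<one>\<^bsub>R\<^esub> \<and>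
      (\<forall>x\<in>center A. x \<otimes>\<^bsub>A\<^esub> character_idempotent R A \<beta> M
        = central_character R A M x \<odot>\<^bsub>A\<^esub> character_idempotent R A \<beta> M)) \<and>
     (\<forall>n x y z. dual_bases A \<beta> n x y \<longrightarrow> z = (\<Oplus>\<^bsub>A\<^esub> i\<in>{1..n}. x i \<otimes>\<^bsub>A\<^esub> y i) \<longrightarrow>
      z \<in> center A \<and>
      central_character R A M z \<otimes>\<^bsub>R\<^esub> rank R (restrict_scalars A M)
        = form_index R A \<beta> M \<otimes>\<^bsub>R\<^esub> rank R (principal_right_ideal A (character_idempotent R A \<beta> M)))"
proof -
  interpret S: symmetric_algebra R A \<beta>
    using assms by (intro symmetric_algebra.intro symmetric_algebra_axioms.intro)
  have loc: "scalar_corner_algebra R A \<beta> n x y e" if "dual_bases A \<beta> n x y" for n x y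
    using that assms S.symmetric_algebra_axioms
      S.scalar_corner_of_scalar_endomorphisms[of e]
    by (intro scalar_corner_algebra.intro dual_bases_algebra.intro
        scalar_corner_algebra_axioms.intro dual_bases_algebra_axioms.intro) simp_all
  obtain n x y where "dual_bases A \<beta> n x y"
    using S.dual_bases_exist assms by blast
  then interpret C: scalar_corner_algebra R A \<beta> n x y e by (rule loc)
  \<comment> \<open>The quantities in (c) other than \<open>z\<close> do not depend on dual bases, so the given ones
    may serve as the fixed ones.\<close>
  have "z \<in> center A \<and>
      central_character R A M z \<otimes>\<^bsub>R\<^esub> rank R (restrict_scalars A M)
        = form_index R A \<beta> M \<otimes>\<^bsub>R\<^esub> rank R (principal_right_ideal A (character_idempotent R A \<beta> M))"
    if dual: "dual_bases A \<beta> m u v" and z: "z = (\<Oplus>\<^bsub>A\<^esub> i\<in>{1..m}. u i \<otimes>\<^bsub>A\<^esub> v i)" for m u v z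
  proof -
    interpret D: scalar_corner_algebra R A \<beta> m u v e by (rule loc[OF dual])
    have "z = D.casimir \<one>\<^bsub>A\<^esub>"
      unfolding z D.casimir_def by (intro S.M.finsum_cong') auto
    then show ?thesis
      using D.casimir_central[OF S.one_closed] D.rank_formula by (simp add: M_def)
  qed
  then show ?thesis
    unfolding M_def
    using C.form_index_unit C.character_idempotent_central C.character_idempotent_idem
      C.central_character_character_idempotent C.center_mult_character_idempotent
    by blast
qed

end
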